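(* Let $\Phi$ be a TD system on $V$ of $q$-Racah type with diameter $d\ge1$ and associated nonzero scalars $q,a,b\in\mathbb{K}$. View $V$ as the $U_q(\mathfrak{sl}_2)$-module in which $e,f,k,k^{-1}$ act as $(q-q^{-1})^{-1}\psi$, $(q-q^{-1})^{-1}R$, $K$, $K^{-1}$ respectively. Then the $U_q(\mathfrak{sl}_2)$-module $V$ is semisimple. Moreover, if $W$ is an irreducible $U_q(\mathfrak{sl}_2)$-submodule of $V$, then there exists an integer $i$ $(0\le i\le d/2)$ such that $W$ is isomorphic to $L(d-2i,1)$.
   Context: Let $\mathbb{K}$ be an algebraically closed field, $V$ a nonzero finite-dimensional $\mathbb{K}$-vector space, $\mathrm{End}(V)$ the algebra of linear maps $V\to V$, and $I$ the identity. TD pairs and systems. A tridiagonal (TD) pair on $V$ is an ordered pair $A,A^*\in\mathrm{End}(V)$ such that: (i) each of $A,A^*$ is diagonalizable; (ii) there is an ordering $\{V_i\}_{i=0}^d$ of the eigenspaces of $A$ with $A^*V_i\subseteq V_{i-1}+V_i+V_{i+1}$ for $0\le i\le d$ ($V_{-1}=V_{d+1}=0$); (iii) there is an ordering $\{V_i^*\}_{i=0}^\delta$ of the eigenspaces of $A^*$ with $AV_i^*\subseteq V_{i-1}^*+V_i^*+V_{i+1}^*$ for $0\le i\le \delta$ ($V^*_{-1}=V^*_{\delta+1}=0$); (iv) there is no subspace $W$ with $AW\subseteq W$, $A^*W\subseteq W$, $W\ne0$, $W\neq V$. It is known that $d=\delta$ (the diameter); assume $d\ge1$. Orderings as in (ii),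 (iii) are called standard. The primitive idempotent for an eigenspace of a diagonalizable map is the projection onto it along the sum of the other eigenspaces; an ordering of the primitive idempotents is standard if the corresponding ordering of eigenspaces is. A TD system on $V$ is a sequence $\Phi=(A;\{E_i\}_{i=0}^d;A^*;\{E_i^*\}_{i=0}^d)$ where $A,A^*$ is a TD pair on $V$ and $\{E_i\}$ (resp. $\{E_i^*\}$) is a standard ordering of the primitive idempotents of $A$ (resp. $A^*$). Let $\theta_i$ (resp. $\theta_i^*$) be the eigenvalue of $A$ (resp. $A^*$) for $E_i$ (resp. $E_i^*$). $\Phi$ has $q$-Racah type, with scalars $q,a,b$, if $q,a,b\in\mathbb{K}$ are nonzero, $q^4\ne1$, and $\theta_i=aq^{d-2i}+a^{-1}q^{2i-d}$, $\theta_i^*=bq^{d-2i}+b^{-1}q^{2i-d}$ for $0\le i\le d$. Split decomposition. For $0\le i\le d$ let $U_i=(E_0^*V+\cdots+E_i^*V)\cap(E_iV+\cdots+E_dV)$. It is known that $V=\bigoplus_{i=0}^dU_i$, with all summands nonzero. For $0\le i\le d/2$ let $K_i=(E_0^*V+\cdots+E_i^*V)\cap(E_iV+\cdots+E_{d-i}V)$. The maps. $K\in\mathrm{End}(V)$ acts on $U_i$ as $q^{d-2i}I$ for $0\le i\le d$; it is invertible. Put $R=A-aK-a^{-1}K^{-1}$. The map $\psi$ is the element of $\mathrm{End}(V)$, known to exist and be unique, such that $\psi R-R\psi=(q-q^{-1})(K-K^{-1})$ and $\psi K_i=0$ for $0\le i\le d/2$. $U_q(\mathfrak{sl}_2)$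 is the unital associative $\mathbb{K}$-algebra with generators $e,f,k,k^{-1}$ and relations $kk^{-1}=k^{-1}k=1$, $kek^{-1}=q^2e$, $kfk^{-1}=q^{-2}f$, $ef-fe=\frac{k-k^{-1}}{q-q^{-1}}$. The assignment in the claim does define a $U_q(\mathfrak{sl}_2)$-module structure on $V$. A finite-dimensional module is semisimple if it is a direct sum of irreducible modules. With $[n]_q=\frac{q^n-q^{-n}}{q-q^{-1}}$, for $n\in\{0,1,2,\dots\}$ and $\varepsilon\in\{1,-1\}$, $L(n,\varepsilon)$ is the $U_q(\mathfrak{sl}_2)$-module with basis $\{v_i\}_{i=0}^n$ such that $ev_i=\varepsilon[n+1-i]_qv_{i-1}$ $(1\le i\le n)$, $ev_0=0$; $fv_i=[i+1]_qv_{i+1}$ $(0\le i\le n-1)$, $fv_n=0$; $kv_i=\varepsilon q^{n-2i}v_i$ $(0\le i\le n)$. *)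

theory Defs
  imports
    "HOL-Computational_Algebra.Computational_Algebra"
    "HOL-Algebra.QuotRing"
    "HOL-Library.Function_Algebras"
    "HOL-Library.FuncSet"
begin

section \<open>Linear algebra\<close>

text \<open>
  The vector space \<open>V\<close> is the whole type \<open>'v\<close>, with scalar multiplication
  \<open>s\<close>; endomorphisms of \<open>V\<close> are functions \<open>'v \<Rightarrow> 'v\<close>.
\<close>

definition eigenspace :: "('k::field \<Rightarrow> 'v::ab_group_add \<Rightarrow> 'v) \<Rightarrow> ('v \<Rightarrow> 'v) \<Rightarrow> 'k \<Rightarrow> 'v set" where
  "eigenspace s A \<theta> = {v. A v = s \<theta> v}"

definition eigenspaces :: "('k::field \<Rightarrow> 'v::ab_group_add \<Rightarrow> 'v) \<Rightarrow> ('v \<Rightarrow> 'v) \<Rightarrow> 'v set set" where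
  "eigenspaces s A = {W. W \<noteq> {0} \<and> (\<exists>\<theta>. W = eigenspace s A \<theta>)}"

definition diagonalizable :: "('k::field \<Rightarrow> 'v::ab_group_add \<Rightarrow> 'v) \<Rightarrow> ('v \<Rightarrow> 'v) \<Rightarrow> bool" where
  "diagonalizable s A \<longleftrightarrow>
     (\<exists>B. \<not> module.dependent s B \<and> module.span s B = UNIV \<and> (\<forall>b\<in>B. \<exists>\<theta>. A b = s \<theta> b))"

definition subspace_sum :: "'i set \<Rightarrow> ('i \<Rightarrow> 'v::ab_group_add set) \<Rightarrow> 'v set" where
  "subspace_sum J W = {\<Sum>j\<in>J. w j | w. \<forall>j\<in>J. w j \<in> W j}"

definition is_direct_sum :: "'v::ab_group_add set \<Rightarrow> 'i set \<Rightarrow> ('i \<Rightarrow> 'v set) \<Rightarrow> bool" where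
  "is_direct_sum C J W \<longleftrightarrow>
     (\<forall>j\<in>J. W j \<subseteq> C) \<and> (\<forall>v\<in>C. \<exists>!w. w \<in> Pi\<^sub>E J W \<and> v = (\<Sum>j\<in>J. w j))"


section \<open>Tridiagonal pairs and systems\<close>

text \<open>
  In the tridiagonal condition, \<open>i - 1\<close> is truncated subtraction, so the terms
  with index \<open>-1\<close> and \<open>d + 1\<close> are omitted from the sum, i.e. taken to be zero.
\<close>

definition standard_ordering ::
  "('k::field \<Rightarrow> 'v::ab_group_add \<Rightarrow> 'v) \<Rightarrow> nat \<Rightarrow> ('v \<Rightarrow> 'v) \<Rightarrow> ('v \<Rightarrow> 'v) \<Rightarrow> (nat \<Rightarrow> 'v set) \<Rightarrow> bool" where
  "standard_ordering s d A B W \<longleftrightarrow>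
     bij_betw W {0..d} (eigenspaces s A) \<and>
     (\<forall>i\<le>d. B ` W i \<subseteq> subspace_sum {i - 1..min d (i + 1)} W)"

definition td_pair ::
  "('k::field \<Rightarrow> 'v::ab_group_add \<Rightarrow> 'v) \<Rightarrow> ('v \<Rightarrow> 'v) \<Rightarrow> ('v \<Rightarrow> 'v) \<Rightarrow> bool" where
  "td_pair s A As \<longleftrightarrow>
     Vector_Spaces.linear s s A \<and> Vector_Spaces.linear s s As \<and>
     diagonalizable s A \<and> diagonalizable s As \<and>
     (\<exists>d W. standard_ordering s d A As W) \<and>
     (\<exists>\<delta> Ws. standard_ordering s \<delta> As A Ws) \<and>
     \<not> (\<exists>W. module.subspace s W \<and> A ` W \<subseteq> W \<and> As ` W \<subseteq> W \<and> W \<noteq> {0} \<and> W \<noteq> UNIV)"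

definition primitive_idempotent ::
  "('k::field \<Rightarrow> 'v::ab_group_add \<Rightarrow> 'v) \<Rightarrow> ('v \<Rightarrow> 'v) \<Rightarrow> 'v set \<Rightarrow> ('v \<Rightarrow> 'v) \<Rightarrow> bool" where
  "primitive_idempotent s A W E \<longleftrightarrow>
     W \<in> eigenspaces s A \<and> Vector_Spaces.linear s s E \<and>
     (\<forall>v\<in>W. E v = v) \<and> (\<forall>v \<in> module.span s (\<Union>(eigenspaces s A - {W})). E v = 0)"

definition standard_idempotents ::
  "('k::field \<Rightarrow> 'v::ab_group_add \<Rightarrow> 'v) \<Rightarrow> nat \<Rightarrow> ('v \<Rightarrow> 'v) \<Rightarrow> ('v \<Rightarrow> 'v) \<Rightarrow> (nat \<Rightarrow> 'v \<Rightarrow> 'v) \<Rightarrow> bool" where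
  "standard_idempotents s d A B E \<longleftrightarrow>
     (\<exists>W. standard_ordering s d A B W \<and> (\<forall>i\<le>d. primitive_idempotent s A (W i) (E i)))"

definition td_system ::
  "('k::field \<Rightarrow> 'v::ab_group_add \<Rightarrow> 'v) \<Rightarrow> nat \<Rightarrow> ('v \<Rightarrow> 'v) \<Rightarrow> (nat \<Rightarrow> 'v \<Rightarrow> 'v)
     \<Rightarrow> ('v \<Rightarrow> 'v) \<Rightarrow> (nat \<Rightarrow> 'v \<Rightarrow> 'v) \<Rightarrow> bool" where
  "td_system s d A E As Es \<longleftrightarrow>
     td_pair s A As \<and> standard_idempotents s d A As E \<and> standard_idempotents s d As A Es"

text \<open>The eigenvalue of \<open>A\<close> for \<open>E i\<close> is the scalar \<open>\<theta>\<close> whose eigenspace is \<open>E i V\<close>.\<close>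

definition q_racah_type ::
  "('k::field \<Rightarrow> 'v::ab_group_add \<Rightarrow> 'v) \<Rightarrow> nat \<Rightarrow> ('v \<Rightarrow> 'v) \<Rightarrow> (nat \<Rightarrow> 'v \<Rightarrow> 'v)
     \<Rightarrow> ('v \<Rightarrow> 'v) \<Rightarrow> (nat \<Rightarrow> 'v \<Rightarrow> 'v) \<Rightarrow> 'k \<Rightarrow> 'k \<Rightarrow> 'k \<Rightarrow> bool" where
  "q_racah_type s d A E As Es q a b \<longleftrightarrow>
     q \<noteq> 0 \<and> a \<noteq> 0 \<and> b \<noteq> 0 \<and> q ^ 4 \<noteq> 1 \<and>
     (\<forall>i\<le>d. range (E i) =
        eigenspace s A (a * q powi (int d - 2 * int i) + inverse a * q powi (2 * int i - int d))) \<and>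
     (\<forall>i\<le>d. range (Es i) =
        eigenspace s As (b * q powi (int d - 2 * int i) + inverse b * q powi (2 * int i - int d)))"


section \<open>The split decomposition and the maps \<open>K\<close>, \<open>R\<close>, \<open>\<psi>\<close>\<close>

definition split_U ::
  "nat \<Rightarrow> (nat \<Rightarrow> 'v \<Rightarrow> 'v::ab_group_add) \<Rightarrow> (nat \<Rightarrow> 'v \<Rightarrow> 'v) \<Rightarrow> nat \<Rightarrow> 'v set" where
  "split_U d E Es i =
     subspace_sum {0..i} (\<lambda>j. range (Es j)) \<inter> subspace_sum {i..d} (\<lambda>j. range (E j))"

definition split_K ::
  "nat \<Rightarrow> (nat \<Rightarrow> 'v \<Rightarrow> 'v::ab_group_add) \<Rightarrow> (nat \<Rightarrow> 'v \<Rightarrow> 'v) \<Rightarrow> nat \<Rightarrow> 'v set" where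
  "split_K d E Es i =
     subspace_sum {0..i} (\<lambda>j. range (Es j)) \<inter> subspace_sum {i..d - i} (\<lambda>j. range (E j))"

definition is_K_map ::
  "('k::field \<Rightarrow> 'v::ab_group_add \<Rightarrow> 'v) \<Rightarrow> nat \<Rightarrow> (nat \<Rightarrow> 'v \<Rightarrow> 'v) \<Rightarrow> (nat \<Rightarrow> 'v \<Rightarrow> 'v)
     \<Rightarrow> 'k \<Rightarrow> ('v \<Rightarrow> 'v) \<Rightarrow> bool" where
  "is_K_map s d E Es q K \<longleftrightarrow>
     Vector_Spaces.linear s s K \<and>
     (\<forall>i\<le>d. \<forall>u\<in>split_U d E Es i. K u = s (q powi (int d - 2 * int i)) u)"

definition R_map ::
  "('k::field \<Rightarrow> 'v::ab_group_add \<Rightarrow> 'v) \<Rightarrow> ('v \<Rightarrow> 'v) \<Rightarrow> 'k \<Rightarrow> ('v \<Rightarrow> 'v) \<Rightarrow> 'v \<Rightarrow> 'v" where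
  "R_map s A a K v = A v - s a (K v) - s (inverse a) (inv_into UNIV K v)"

definition is_psi_map ::
  "('k::field \<Rightarrow> 'v::ab_group_add \<Rightarrow> 'v) \<Rightarrow> nat \<Rightarrow> (nat \<Rightarrow> 'v \<Rightarrow> 'v) \<Rightarrow> (nat \<Rightarrow> 'v \<Rightarrow> 'v)
     \<Rightarrow> 'k \<Rightarrow> ('v \<Rightarrow> 'v) \<Rightarrow> ('v \<Rightarrow> 'v) \<Rightarrow> ('v \<Rightarrow> 'v) \<Rightarrow> bool" where
  "is_psi_map s d E Es q K R \<psi> \<longleftrightarrow>
     Vector_Spaces.linear s s \<psi> \<and>
     (\<forall>v. \<psi> (R v) - R (\<psi> v) = s (q - inverse q) (K v - inv_into UNIV K v)) \<and>
     (\<forall>i. 2 * i \<le> d \<longrightarrow> (\<forall>v\<in>split_K d E Es i. \<psi> v = 0))"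


section \<open>The algebra \<open>U\<^sub>q(sl\<^sub>2)\<close>\<close>

datatype uq_gen = Gen_e | Gen_f | Gen_k | Gen_kinv

text \<open>
  An element of the free algebra on \<open>uq_gen\<close> is its finitely supported
  coefficient function on words.  Addition, subtraction and zero are the pointwise
  ones of \<^theory>\<open>HOL-Library.Function_Algebras\<close>; the product extends
  concatenation of words.
\<close>

type_synonym 'k uq_free = "uq_gen list \<Rightarrow> 'k"

definition uq_term :: "'k::field \<Rightarrow> uq_gen list \<Rightarrow> 'k uq_free" where
  "uq_term c w = (\<lambda>u. if u = w then c else 0)"

definition free_alg :: "('k::field uq_free) ring" where
  "free_alg =
     \<lparr>carrier = {p. finite {w. p w \<noteq> 0}},
      mult = (\<lambda>p r w. \<Sum>i\<le>length w. p (take i w) * r (drop i w)),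
      one = uq_term 1 [],
      zero = 0,
      add = (+)\<rparr>"

definition uq_relations :: "'k::field \<Rightarrow> 'k uq_free set" where
  "uq_relations q =
     {uq_term 1 [Gen_k, Gen_kinv] - uq_term 1 [],
      uq_term 1 [Gen_kinv, Gen_k] - uq_term 1 [],
      uq_term 1 [Gen_k, Gen_e, Gen_kinv] - uq_term (q ^ 2) [Gen_e],
      uq_term 1 [Gen_k, Gen_f, Gen_kinv] - uq_term (inverse q ^ 2) [Gen_f],
      uq_term 1 [Gen_e, Gen_f] - uq_term 1 [Gen_f, Gen_e]
        - (uq_term (1 / (q - inverse q)) [Gen_k] - uq_term (1 / (q - inverse q)) [Gen_kinv])}"

definition Uq_ideal :: "'k::field \<Rightarrow> 'k uq_free set" where
  "Uq_ideal q = genideal free_alg (uq_relations q)"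

definition Uq :: "'k::field \<Rightarrow> ('k uq_free set) ring" where
  "Uq q = free_alg Quot Uq_ideal q"

definition Uq_class :: "'k::field \<Rightarrow> 'k uq_free \<Rightarrow> 'k uq_free set" where
  "Uq_class q p = Uq_ideal q +>\<^bsub>free_alg\<^esub> p"


section \<open>Modules over \<open>U\<^sub>q(sl\<^sub>2)\<close>\<close>

text \<open>
  A module is given by a subspace \<open>C\<close> of a vector space with scalar multiplication
  \<open>s\<close>, together with an action \<open>act\<close> of the elements of \<open>Uq q\<close>, of which only
  the values on \<open>C\<close> matter.  The last clause says that the scalars contained in
  the algebra act as they do on the vector space.
\<close>

definition uq_module ::
  "'k::field \<Rightarrow> ('k \<Rightarrow> 'v::ab_group_add \<Rightarrow> 'v) \<Rightarrow> 'v set \<Rightarrow> ('k uq_free set \<Rightarrow> 'v \<Rightarrow> 'v) \<Rightarrow> bool" where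
  "uq_module q s C act \<longleftrightarrow>
     vector_space s \<and> module.subspace s C \<and>
     (\<forall>x\<in>carrier (Uq q). \<forall>v\<in>C. act x v \<in> C) \<and>
     (\<forall>x\<in>carrier (Uq q). \<forall>u\<in>C. \<forall>v\<in>C. act x (u + v) = act x u + act x v) \<and>
     (\<forall>x\<in>carrier (Uq q). \<forall>c. \<forall>v\<in>C. act x (s c v) = s c (act x v)) \<and>
     (\<forall>x\<in>carrier (Uq q). \<forall>y\<in>carrier (Uq q). \<forall>v\<in>C.
        act (x \<oplus>\<^bsub>Uq q\<^esub> y) v = act x v + act y v \<and>
        act (x \<otimes>\<^bsub>Uq q\<^esub> y) v = act x (act y v)) \<and>
     (\<forall>v\<in>C. act \<one>\<^bsub>Uq q\<^esub> v = v) \<and>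
     (\<forall>c. \<forall>v\<in>C. act (Uq_class q (uq_term c [])) v = s c v)"

definition uq_submodule ::
  "'k::field \<Rightarrow> ('k \<Rightarrow> 'v::ab_group_add \<Rightarrow> 'v) \<Rightarrow> 'v set \<Rightarrow> ('k uq_free set \<Rightarrow> 'v \<Rightarrow> 'v)
     \<Rightarrow> 'v set \<Rightarrow> bool" where
  "uq_submodule q s C act W \<longleftrightarrow>
     module.subspace s W \<and> W \<subseteq> C \<and> (\<forall>x\<in>carrier (Uq q). \<forall>w\<in>W. act x w \<in> W)"

definition uq_irreducible ::
  "'k::field \<Rightarrow> ('k \<Rightarrow> 'v::ab_group_add \<Rightarrow> 'v) \<Rightarrow> 'v set \<Rightarrow> ('k uq_free set \<Rightarrow> 'v \<Rightarrow> 'v) \<Rightarrow> bool" where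
  "uq_irreducible q s C act \<longleftrightarrow>
     uq_module q s C act \<and> C \<noteq> {0} \<and> (\<forall>W. uq_submodule q s C act W \<longrightarrow> W = {0} \<or> W = C)"

text \<open>Used only for finite-dimensional modules, where finite direct sums suffice.\<close>

definition uq_semisimple ::
  "'k::field \<Rightarrow> ('k \<Rightarrow> 'v::ab_group_add \<Rightarrow> 'v) \<Rightarrow> 'v set \<Rightarrow> ('k uq_free set \<Rightarrow> 'v \<Rightarrow> 'v) \<Rightarrow> bool" where
  "uq_semisimple q s C act \<longleftrightarrow>
     uq_module q s C act \<and>
     (\<exists>(m::nat) W. (\<forall>j<m. uq_submodule q s C act (W j) \<and> uq_irreducible q s (W j) act) \<and>
        is_direct_sum C {..<m} W)"

definition uq_isomorphic ::
  "'k::field \<Rightarrow> ('k \<Rightarrow> 'v::ab_group_add \<Rightarrow> 'v) \<Rightarrow> 'v set \<Rightarrow> ('k uq_free set \<Rightarrow> 'v \<Rightarrow> 'v)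
     \<Rightarrow> ('k \<Rightarrow> 'w::ab_group_add \<Rightarrow> 'w) \<Rightarrow> 'w set \<Rightarrow> ('k uq_free set \<Rightarrow> 'w \<Rightarrow> 'w) \<Rightarrow> bool" where
  "uq_isomorphic q s C act s' C' act' \<longleftrightarrow>
     (\<exists>\<phi>. bij_betw \<phi> C C' \<and>
        (\<forall>u\<in>C. \<forall>v\<in>C. \<phi> (u + v) = \<phi> u + \<phi> v) \<and>
        (\<forall>c. \<forall>v\<in>C. \<phi> (s c v) = s' c (\<phi> v)) \<and>
        (\<forall>x\<in>carrier (Uq q). \<forall>v\<in>C. \<phi> (act x v) = act' x (\<phi> v)))"

text \<open>
  The action of \<open>U\<^sub>q(sl\<^sub>2)\<close> in which the generators act as given operators: an
  element of \<open>Uq q\<close> is a coset of the ideal of relations, and all its members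
  evaluate to the same operator when the given operators satisfy the relations.
\<close>

definition uq_eval ::
  "('k::field \<Rightarrow> 'v::ab_group_add \<Rightarrow> 'v) \<Rightarrow> (uq_gen \<Rightarrow> 'v \<Rightarrow> 'v) \<Rightarrow> 'k uq_free \<Rightarrow> 'v \<Rightarrow> 'v" where
  "uq_eval s g p v = (\<Sum>w | p w \<noteq> 0. s (p w) (foldr g w v))"

definition uq_ops :: "('v \<Rightarrow> 'v) \<Rightarrow> ('v \<Rightarrow> 'v) \<Rightarrow> ('v \<Rightarrow> 'v) \<Rightarrow> ('v \<Rightarrow> 'v) \<Rightarrow> uq_gen \<Rightarrow> 'v \<Rightarrow> 'v" where
  "uq_ops e f k kinv x =
     (case x of Gen_e \<Rightarrow> e | Gen_f \<Rightarrow> f | Gen_k \<Rightarrow> k | Gen_kinv \<Rightarrow> kinv)"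

definition uq_action ::
  "('k::field \<Rightarrow> 'v::ab_group_add \<Rightarrow> 'v) \<Rightarrow> ('v \<Rightarrow> 'v) \<Rightarrow> ('v \<Rightarrow> 'v) \<Rightarrow> ('v \<Rightarrow> 'v) \<Rightarrow> ('v \<Rightarrow> 'v)
     \<Rightarrow> 'k uq_free set \<Rightarrow> 'v \<Rightarrow> 'v" where
  "uq_action s e f k kinv X v = the_elem ((\<lambda>p. uq_eval s (uq_ops e f k kinv) p v) ` X)"


section \<open>The modules \<open>L(n, \<epsilon>)\<close>\<close>

text \<open>
  \<open>L(n, \<epsilon>)\<close> is realized on the sequences \<open>x\<close> supported on \<open>{0..n}\<close>, with the
  unit sequences \<open>L_basis i\<close> as the basis \<open>v\<^sub>i\<close>; the operators extend linearly the
  prescribed values on this basis.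
\<close>

definition qint :: "'k::field \<Rightarrow> nat \<Rightarrow> 'k" where
  "qint q n = (q ^ n - inverse q ^ n) / (q - inverse q)"

definition L_scale :: "'k::field \<Rightarrow> (nat \<Rightarrow> 'k) \<Rightarrow> nat \<Rightarrow> 'k" where
  "L_scale c x = (\<lambda>i. c * x i)"

definition L_carrier :: "nat \<Rightarrow> (nat \<Rightarrow> 'k::field) set" where
  "L_carrier n = {x. \<forall>i>n. x i = 0}"

definition L_basis :: "nat \<Rightarrow> nat \<Rightarrow> 'k::field" where
  "L_basis i = (\<lambda>j. if j = i then 1 else 0)"

definition L_e :: "'k::field \<Rightarrow> nat \<Rightarrow> 'k \<Rightarrow> (nat \<Rightarrow> 'k) \<Rightarrow> nat \<Rightarrow> 'k" where
  "L_e q n \<epsilon> x = (\<Sum>i=1..n. L_scale (x i) (L_scale (\<epsilon> * qint q (n + 1 - i)) (L_basis (i - 1))))"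

definition L_f :: "'k::field \<Rightarrow> nat \<Rightarrow> (nat \<Rightarrow> 'k) \<Rightarrow> nat \<Rightarrow> 'k" where
  "L_f q n x = (\<Sum>i<n. L_scale (x i) (L_scale (qint q (i + 1)) (L_basis (i + 1))))"

definition L_k :: "'k::field \<Rightarrow> nat \<Rightarrow> 'k \<Rightarrow> (nat \<Rightarrow> 'k) \<Rightarrow> nat \<Rightarrow> 'k" where
  "L_k q n \<epsilon> x = (\<Sum>i\<le>n. L_scale (x i) (L_scale (\<epsilon> * q powi (int n - 2 * int i)) (L_basis i)))"

definition L_kinv :: "'k::field \<Rightarrow> nat \<Rightarrow> 'k \<Rightarrow> (nat \<Rightarrow> 'k) \<Rightarrow> nat \<Rightarrow> 'k" where
  "L_kinv q n \<epsilon> x =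
     (\<Sum>i\<le>n. L_scale (x i) (L_scale (inverse (\<epsilon> * q powi (int n - 2 * int i))) (L_basis i)))"

definition L_action :: "'k::field \<Rightarrow> nat \<Rightarrow> 'k \<Rightarrow> 'k uq_free set \<Rightarrow> (nat \<Rightarrow> 'k) \<Rightarrow> nat \<Rightarrow> 'k" where
  "L_action q n \<epsilon> = uq_action L_scale (L_e q n \<epsilon>) (L_f q n) (L_k q n \<epsilon>) (L_kinv q n \<epsilon>)"

end

theory Submission
  imports Defs
begin

text \<open>
  Write \<open>\<theta> i\<close> for the eigenvalue of \<open>A\<close> on \<open>E i V\<close>.  Since \<open>K\<close> acts on \<open>U i\<close> as
  \<open>q ^ (d - 2i)\<close>, the map \<open>R\<close> acts there as \<open>A - \<theta> i\<close>, which sends \<open>U i\<close> into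
  \<open>U (i + 1)\<close>.  The facts about the split decomposition all come from the
  irreducibility of \<open>V\<close> under \<open>A\<close> and \<open>A\<^sup>*\<close>, through one device: if the members of a
  family of subspaces are moved by \<open>A\<close> and by \<open>A\<^sup>*\<close> into members of the family, up to
  subtracting scalar multiples of the identity, then the family spans \<open>0\<close> or \<open>V\<close>
  (\<open>span_UN_invariant\<close>).  Applied to the \<open>U i\<close> this gives \<open>V = U 0 + \<dots> + U d\<close>, and
  applied to \<open>(E\<^sup>*\<^sub>0 V + \<dots> + E\<^sup>*\<^sub>i\<^sub>-\<^sub>1 V) \<inter> (E\<^sub>i V + \<dots> + E\<^sub>d V)\<close> it shows that these
  intersections vanish (\<open>eigen_sums_disjoint\<close>).

  The reversed ordering of the \<open>E i\<close> is again standard.  The second fact, for that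
  ordering, says that \<open>R ^ (d - 2i)\<close> is injective from \<open>U i\<close> to \<open>U (d - i)\<close>; comparing
  the dimensions of \<open>U i\<close>, \<open>E i V\<close> and \<open>E\<^sup>* i V\<close> for both orderings shows
  \<open>dim (U i) = dim (U (d - i))\<close>, so this map is bijective.  Now the space
  \<open>K\<^sub>i\<close> of the theorem, called \<open>K_space i\<close> below, is the kernel of
  \<open>R ^ (d - 2i + 1)\<close> on \<open>U i\<close>, whence \<open>U i = R (U (i - 1)) + K_space i\<close> for \<open>2i \<le> d\<close> and
  \<open>U i = R (U (i - 1))\<close> for larger \<open>i\<close> (\<open>U_Suc\<close>).  Thus the spaces \<open>K_space i\<close> generate \<open>V\<close>
  under \<open>R\<close>.  Induction along this recursion and the commutator of \<open>\<psi>\<close> and \<open>R\<close> give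
  \<open>\<psi> (U i) \<subseteq> U (i - 1)\<close> (\<open>psi_U_Suc\<close>), and the defining relations of \<open>U\<^sub>q(sl\<^sub>2)\<close> follow.

  Distinctness of the \<open>\<theta> i\<close> forces \<open>q ^ (2n) \<noteq> 1\<close> for \<open>1 \<le> n \<le> d\<close>.  Hence the weights of
  \<open>V\<close> are distinct and the relevant \<open>q\<close>-integers nonzero, even if \<open>q\<close> is a root of unity.
  A nonzero vector \<open>u\<close> of \<open>K_space i\<close> satisfies \<open>e u = 0\<close>, has weight \<open>q ^ (d - 2i)\<close> and is
  killed by \<open>f ^ (d - 2i + 1)\<close>, so it generates a copy of \<open>L(d - 2i, 1)\<close>, which is
  irreducible.  Hence a maximal direct sum of irreducible submodules contains every
  \<open>K_space i\<close> and is \<open>V\<close> (\<open>semisimple_if_irreducibles_exhaust\<close>).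

  Conversely, an irreducible submodule \<open>W\<close> contains a nonzero vector of some \<open>U i\<close>.
  For the least such \<open>i\<close> this vector \<open>u\<close> is killed by \<open>e\<close>, and if \<open>f ^ m u\<close> is the
  last nonzero vector in its string then \<open>0 = e (f ^ (m + 1) u) = [m + 1] [d - 2i - m] f ^ m u\<close>
  forces \<open>m = d - 2i\<close> (\<open>vector_killed_by_e_highest_weight\<close>).  So \<open>W\<close> is the
  module generated by \<open>u\<close>, that is, \<open>L(d - 2i, 1)\<close>.
\<close>

lemma linear_map_simps:
  assumes "Vector_Spaces.linear s1 s2 h"
  shows linear_map_add: "h (x + y) = h x + h y"
    and linear_map_diff: "h (x - y) = h x - h y"
    and linear_map_scale: "h (s1 c x) = s2 c (h x)"
    and linear_map_0: "h 0 = 0"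
    and linear_map_sum: "h (sum g S) = (\<Sum>i\<in>S. h (g i))"
proof -
  interpret module_hom s1 s2 h using assms by (simp add: Vector_Spaces.linear_def)
  show "h (x + y) = h x + h y" "h (x - y) = h x - h y" "h (s1 c x) = s2 c (h x)" "h 0 = 0"
    "h (sum g S) = (\<Sum>i\<in>S. h (g i))"
    by (simp_all add: add diff scale zero sum)
qed

section \<open>The free algebra and evaluation of its elements\<close>

lemma free_alg_simps [simp]:
  "carrier free_alg = {p. finite {w. p w \<noteq> 0}}"
  "\<zero>\<^bsub>free_alg\<^esub> = 0" "\<one>\<^bsub>free_alg\<^esub> = uq_term 1 []" "p \<oplus>\<^bsub>free_alg\<^esub> r = p + r"
  by (simp_all add: free_alg_def)

lemma free_alg_mult:
  "(p \<otimes>\<^bsub>free_alg\<^esub> r) w = (\<Sum>i\<le>length w. p (take i w) * r (drop i w))"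
  by (simp add: free_alg_def)

text \<open>
  The convolution product at a word \<open>w\<close> runs over the ways of cutting \<open>w\<close> in two.
  Indexing it by pairs of words in the supports makes the sum over all \<open>w\<close> a sum
  over a product set, which is how multiplicativity of evaluation is obtained.
\<close>

lemma free_alg_mult_factorizations:
  fixes p r :: "'k::field uq_free"
  assumes "finite {w. p w \<noteq> 0}" "finite {w. r w \<noteq> 0}"
  shows "(p \<otimes>\<^bsub>free_alg\<^esub> r) w =
    (\<Sum>z\<in>{z \<in> {w. p w \<noteq> 0} \<times> {w. r w \<noteq> 0}. fst z @ snd z = w}. p (fst z) * r (snd z))"
proof -
  have inj: "inj_on (\<lambda>i. (take i w, drop i w)) {..length w}"
  proof (rule inj_onI)
    fix i j assume ij: "i \<in> {..length w}" "j \<in> {..length w}"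
      and eq: "(take i w, drop i w) = (take j w, drop j w)"
    have "length (take i w) = i" "length (take j w) = j" using ij by auto
    moreover have "take i w = take j w" using eq by simp
    ultimately show "i = j" by metis
  qed
  have img: "(\<lambda>i. (take i w, drop i w)) ` {..length w} = {z. fst z @ snd z = w}"
  proof (intro Set.set_eqI iffI)
    fix z assume "z \<in> {z. fst z @ snd z = w}"
    then have "z = (take (length (fst z)) w, drop (length (fst z)) w)" "length (fst z) \<le> length w"
      by (auto intro!: prod_eqI)
    then show "z \<in> (\<lambda>i. (take i w, drop i w)) ` {..length w}" by blast
  qed auto
  have fin: "finite {z. fst z @ snd z = w}"
    by (simp add: img [symmetric])
  have "(p \<otimes>\<^bsub>free_alg\<^esub> r) w = (\<Sum>z\<in>{z. fst z @ snd z = w}. p (fst z) * r (snd z))"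
    unfolding free_alg_mult img [symmetric] sum.reindex [OF inj] by simp
  also have "\<dots> = (\<Sum>z\<in>{z \<in> {w. p w \<noteq> 0} \<times> {w. r w \<noteq> 0}. fst z @ snd z = w}. p (fst z) * r (snd z))"
    by (rule sum.mono_neutral_right) (use fin in auto)
  finally show ?thesis .
qed

lemma free_alg_mult_support:
  fixes p r :: "'k::field uq_free"
  assumes "finite {w. p w \<noteq> 0}" "finite {w. r w \<noteq> 0}"
  shows "{w. (p \<otimes>\<^bsub>free_alg\<^esub> r) w \<noteq> 0} \<subseteq> (\<lambda>z. fst z @ snd z) ` ({w. p w \<noteq> 0} \<times> {w. r w \<noteq> 0})"
proof
  fix w assume "w \<in> {w. (p \<otimes>\<^bsub>free_alg\<^esub> r) w \<noteq> 0}"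
  then have "(\<Sum>z\<in>{z \<in> {w. p w \<noteq> 0} \<times> {w. r w \<noteq> 0}. fst z @ snd z = w}. p (fst z) * r (snd z)) \<noteq> 0"
    by (simp only: free_alg_mult_factorizations [OF assms] mem_Collect_eq not_False_eq_True)
  then obtain z where "z \<in> {z \<in> {w. p w \<noteq> 0} \<times> {w. r w \<noteq> 0}. fst z @ snd z = w}"
    by (rule sum.not_neutral_contains_not_neutral)
  then show "w \<in> (\<lambda>z. fst z @ snd z) ` ({w. p w \<noteq> 0} \<times> {w. r w \<noteq> 0})" by blast
qed

lemma free_alg_mult_closed:
  fixes p r :: "'k::field uq_free"
  assumes "finite {w. p w \<noteq> 0}" "finite {w. r w \<noteq> 0}"
  shows "finite {w. (p \<otimes>\<^bsub>free_alg\<^esub> r) w \<noteq> 0}"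
  by (rule finite_subset [OF free_alg_mult_support [OF assms]]) (use assms in simp)

text \<open>
  Both sides sum over the ways of cutting \<open>w\<close> into three pieces; the reindexing
  passes from the position of the second cut to the length of the middle piece.
\<close>

lemma free_alg_mult_assoc:
  fixes p r t :: "'k::field uq_free"
  shows "(p \<otimes>\<^bsub>free_alg\<^esub> r) \<otimes>\<^bsub>free_alg\<^esub> t = p \<otimes>\<^bsub>free_alg\<^esub> (r \<otimes>\<^bsub>free_alg\<^esub> t)"
proof
  fix w :: "uq_gen list"
  define n where "n = length w"
  define g where "g i j = p (take i w) * r (take j (drop i w)) * t (drop (i + j) w)" for i j
  have "((p \<otimes>\<^bsub>free_alg\<^esub> r) \<otimes>\<^bsub>free_alg\<^esub> t) w = (\<Sum>k\<le>n. \<Sum>i\<le>k. g i (k - i))"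
    unfolding free_alg_mult n_def
    by (intro sum.cong refl)
       (auto simp: g_def sum_distrib_right drop_take min_def intro!: sum.cong)
  also have "\<dots> = (\<Sum>(i,j)\<in>{(i,j). i + j \<le> n}. g i j)"
    by (rule sum.triangle_reindex_eq [symmetric])
  also have "{(i,j). i + j \<le> n} = (SIGMA i:{..n}. {..n - i})"
    by auto
  also have "(\<Sum>(i,j)\<in>(SIGMA i:{..n}. {..n - i}). g i j) = (\<Sum>i\<le>n. \<Sum>j\<le>n - i. g i j)"
    by (rule sum.Sigma [symmetric]) auto
  also have "\<dots> = (p \<otimes>\<^bsub>free_alg\<^esub> (r \<otimes>\<^bsub>free_alg\<^esub> t)) w"
    unfolding free_alg_mult n_def
    by (intro sum.cong refl)
       (auto simp: g_def sum_distrib_left mult.assoc add.commute intro!: sum.cong)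
  finally show "((p \<otimes>\<^bsub>free_alg\<^esub> r) \<otimes>\<^bsub>free_alg\<^esub> t) w = (p \<otimes>\<^bsub>free_alg\<^esub> (r \<otimes>\<^bsub>free_alg\<^esub> t)) w" .
qed

lemma finite_support_add:
  fixes p r :: "'k::field uq_free"
  assumes "finite {w. p w \<noteq> 0}" "finite {w. r w \<noteq> 0}"
  shows "finite {w. (p + r) w \<noteq> 0}"
  by (rule finite_subset [of _ "{w. p w \<noteq> 0} \<union> {w. r w \<noteq> 0}"]) (use assms in auto)

lemma finite_support_diff:
  fixes p r :: "'k::field uq_free"
  assumes "finite {w. p w \<noteq> 0}" "finite {w. r w \<noteq> 0}"
  shows "finite {w. (p - r) w \<noteq> 0}"
  by (rule finite_subset [of _ "{w. p w \<noteq> 0} \<union> {w. r w \<noteq> 0}"]) (use assms in auto)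

lemma finite_support_term [simp]: "finite {w'. uq_term c w w' \<noteq> 0}"
  by (rule finite_subset [of _ "{w}"]) (auto simp: uq_term_def)

text \<open>
  The ideal generated by the relations and the quotient by it have their usual
  meaning only once the free algebra is known to be a ring.
\<close>

lemma ring_free_alg: "ring (free_alg :: 'k::field uq_free ring)"
proof (rule ringI)
  show "abelian_group (free_alg :: 'k uq_free ring)"
  proof (rule abelian_groupI)
    fix x :: "'k uq_free" assume "x \<in> carrier free_alg"
    then show "\<exists>y\<in>carrier free_alg. y \<oplus>\<^bsub>free_alg\<^esub> x = \<zero>\<^bsub>free_alg\<^esub>"
      by (intro bexI [of _ "- x"]) auto
  qed (auto simp: add_ac intro!: finite_support_add [unfolded plus_fun_def])
  show "Group.monoid (free_alg :: 'k uq_free ring)"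
  proof (rule monoidI)
    show "x \<otimes>\<^bsub>free_alg\<^esub> y \<in> carrier free_alg"
      if "x \<in> carrier free_alg" "y \<in> carrier free_alg" for x y :: "'k uq_free"
      using that by (simp add: free_alg_mult_closed)
    show "\<one>\<^bsub>free_alg\<^esub> \<in> carrier (free_alg :: 'k uq_free ring)"
      by simp
    show "\<one>\<^bsub>free_alg\<^esub> \<otimes>\<^bsub>free_alg\<^esub> x = x" for x :: "'k uq_free"
    proof
      fix w
      have "(\<one>\<^bsub>free_alg\<^esub> \<otimes>\<^bsub>free_alg\<^esub> x) w = (\<Sum>i\<le>length w. if i = 0 then x w else 0)"
        unfolding free_alg_mult by (intro sum.cong refl) (auto simp: uq_term_def)
      then show "(\<one>\<^bsub>free_alg\<^esub> \<otimes>\<^bsub>free_alg\<^esub> x) w = x w" by simp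
    qed
    show "x \<otimes>\<^bsub>free_alg\<^esub> \<one>\<^bsub>free_alg\<^esub> = x" for x :: "'k uq_free"
    proof
      fix w
      have "(x \<otimes>\<^bsub>free_alg\<^esub> \<one>\<^bsub>free_alg\<^esub>) w = (\<Sum>i\<le>length w. if i = length w then x w else 0)"
        unfolding free_alg_mult by (intro sum.cong refl) (auto simp: uq_term_def)
      then show "(x \<otimes>\<^bsub>free_alg\<^esub> \<one>\<^bsub>free_alg\<^esub>) w = x w" by simp
    qed
  qed (rule free_alg_mult_assoc)
qed (auto simp: fun_eq_iff free_alg_mult algebra_simps sum.distrib)

interpretation free_alg: ring "free_alg :: 'k::field uq_free ring"
  by (rule ring_free_alg)

lemma uq_relations_subset: "uq_relations q \<subseteq> carrier free_alg"
  unfolding uq_relations_def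
  by (auto simp del: fun_diff_def minus_apply intro!: finite_support_diff)

lemma ideal_Uq_ideal: "ideal (Uq_ideal q) (free_alg :: 'k::field uq_free ring)"
  unfolding Uq_ideal_def by (rule free_alg.genideal_ideal [OF uq_relations_subset])

lemma carrier_Uq: "carrier (Uq q) = Uq_class q ` carrier free_alg"
  by (auto simp: Uq_def Uq_class_def FactRing_def A_RCOSETS_def' [where G = free_alg] a_r_coset_def)

lemma Uq_class_closed: "p \<in> carrier free_alg \<Longrightarrow> Uq_class q p \<in> carrier (Uq q)"
  by (simp add: carrier_Uq)

lemma Uq_class_ring_hom: "Uq_class q \<in> ring_hom free_alg (Uq q)"
  using ideal.rcos_ring_hom [OF ideal_Uq_ideal, of q] by (simp add: Uq_def Uq_class_def [abs_def])

lemma (in vector_space) linear_foldr: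
  assumes "\<And>x. Vector_Spaces.linear scale scale (g x)"
  shows "Vector_Spaces.linear scale scale (foldr g w)"
proof (induction w)
  case Nil
  show ?case using linear_id by (simp add: id_def)
next
  case (Cons x w)
  then show ?case
    using Vector_Spaces.linear_compose [OF Cons assms [of x]] by (simp add: comp_def)
qed

text \<open>
  Any finite set containing the support may serve as the index set; this lets
  elements with different supports be summed together.
\<close>

lemma uq_eval_superset:
  assumes "vector_space s" "finite S" "{w. p w \<noteq> 0} \<subseteq> S"
  shows "uq_eval s g p v = (\<Sum>w\<in>S. s (p w) (foldr g w v))"
proof -
  interpret vector_space s by fact
  show ?thesis unfolding uq_eval_def
    by (rule sum.mono_neutral_left) (use assms in auto)
qed

lemma uq_eval_term: "vector_space s \<Longrightarrow> uq_eval s g (uq_term c w) v = s c (foldr g w v)"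
  by (subst uq_eval_superset [where S = "{w}"]) (auto simp: uq_term_def)

lemma uq_eval_add:
  assumes "vector_space s" "p \<in> carrier free_alg" "r \<in> carrier free_alg"
  shows "uq_eval s g (p + r) v = uq_eval s g p v + uq_eval s g r v"
proof -
  interpret vector_space s by fact
  let ?S = "{w. p w \<noteq> 0} \<union> {w. r w \<noteq> 0}"
  have fin: "finite ?S" using assms by simp
  show ?thesis
    by (subst (1 2 3) uq_eval_superset [OF assms(1) fin])
       (auto simp: sum.distrib scale_left_distrib)
qed

lemma uq_eval_diff:
  assumes "vector_space s" "p \<in> carrier free_alg" "r \<in> carrier free_alg"
  shows "uq_eval s g (p - r) v = uq_eval s g p v - uq_eval s g r v"
proof -
  interpret vector_space s by fact
  let ?S = "{w. p w \<noteq> 0} \<union> {w. r w \<noteq> 0}"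
  have fin: "finite ?S" using assms by simp
  show ?thesis
    by (subst (1 2 3) uq_eval_superset [OF assms(1) fin])
       (auto simp: sum_subtractf scale_left_diff_distrib)
qed

lemma uq_eval_linear:
  assumes "vector_space s" "\<And>x. Vector_Spaces.linear s s (g x)"
  shows "uq_eval s g p (u + v) = uq_eval s g p u + uq_eval s g p v"
    and "uq_eval s g p (s c v) = s c (uq_eval s g p v)"
    and "uq_eval s g p 0 = 0"
proof -
  interpret vector_space s by fact
  have lin: "Vector_Spaces.linear s s (foldr g w)" for w
    by (rule linear_foldr [OF assms(2)])
  show "uq_eval s g p (u + v) = uq_eval s g p u + uq_eval s g p v"
    by (simp add: uq_eval_def linear_map_add [OF lin] scale_right_distrib sum.distrib)
  show "uq_eval s g p (s c v) = s c (uq_eval s g p v)"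
    by (simp add: uq_eval_def linear_map_scale [OF lin] scale_sum_right mult.commute)
  show "uq_eval s g p 0 = 0"
    by (simp add: uq_eval_def linear_map_0 [OF lin])
qed

lemma uq_eval_mult:
  assumes "vector_space s" "\<And>x. Vector_Spaces.linear s s (g x)"
    and pr: "p \<in> carrier free_alg" "r \<in> carrier free_alg"
  shows "uq_eval s g (p \<otimes>\<^bsub>free_alg\<^esub> r) v = uq_eval s g p (uq_eval s g r v)"
proof -
  interpret vector_space s by fact
  have lin: "Vector_Spaces.linear s s (foldr g w)" for w
    by (rule linear_foldr [OF assms(2)])
  let ?P = "{w. p w \<noteq> 0}" and ?R = "{w. r w \<noteq> 0}"
  let ?cat = "\<lambda>z. fst z @ snd z :: uq_gen list"
  have fin: "finite ?P" "finite ?R" using pr by auto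
  let ?S = "?cat ` (?P \<times> ?R)"
  have "uq_eval s g (p \<otimes>\<^bsub>free_alg\<^esub> r) v
      = (\<Sum>w\<in>?S. s ((p \<otimes>\<^bsub>free_alg\<^esub> r) w) (foldr g w v))"
    by (rule uq_eval_superset [OF assms(1) _ free_alg_mult_support [OF fin]]) (use fin in simp)
  also have "\<dots> = (\<Sum>w\<in>?S. \<Sum>z\<in>{z \<in> ?P \<times> ?R. ?cat z = w}.
      s (p (fst z)) (foldr g (fst z) (s (r (snd z)) (foldr g (snd z) v))))"
  proof (rule sum.cong [OF refl])
    fix w
    show "s ((p \<otimes>\<^bsub>free_alg\<^esub> r) w) (foldr g w v) = (\<Sum>z\<in>{z \<in> ?P \<times> ?R. ?cat z = w}.
      s (p (fst z)) (foldr g (fst z) (s (r (snd z)) (foldr g (snd z) v))))"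
      unfolding free_alg_mult_factorizations [OF fin] scale_sum_left
      by (rule sum.cong [OF refl]) (auto simp: linear_map_scale [OF lin])
  qed
  also have "\<dots> = (\<Sum>z\<in>?P \<times> ?R. s (p (fst z)) (foldr g (fst z) (s (r (snd z)) (foldr g (snd z) v))))"
    by (rule sum.group) (use fin in auto)
  also have "\<dots> = (\<Sum>x\<in>?P. \<Sum>y\<in>?R. s (p x) (foldr g x (s (r y) (foldr g y v))))"
    by (simp add: sum.cartesian_product case_prod_unfold)
  also have "\<dots> = uq_eval s g p (uq_eval s g r v)"
    by (simp add: uq_eval_def linear_map_sum [OF lin] scale_sum_right)
  finally show ?thesis .
qed

lemma uq_eval_closed:
  assumes "vector_space s" "module.subspace s C" "\<And>x v. v \<in> C \<Longrightarrow> g x v \<in> C" "v \<in> C"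
  shows "uq_eval s g p v \<in> C"
proof -
  interpret vector_space s by fact
  have "foldr g w v \<in> C" for w
    by (induction w) (use assms in auto)
  then show ?thesis
    unfolding uq_eval_def by (intro subspace_sum [OF assms(2)] subspace_scale [OF assms(2)])
qed

text \<open>
  Evaluation is a linear combination of composites of the generators, so a linear
  map that commutes with the generators on an invariant set \<open>C\<close> commutes there with
  every element of the free algebra.
\<close>

lemma uq_eval_intertwine:
  assumes "\<And>x y. T (x + y) = T x + T y" "\<And>c x. T (s' c x) = s c (T x)" "T 0 = 0"
    and h: "\<And>y x. x \<in> C \<Longrightarrow> h y x \<in> C \<and> T (h y x) = g y (T x)"
    and x: "x \<in> C"
  shows "T (uq_eval s' h p x) = uq_eval s g p (T x)"
proof -
  have fold: "foldr h w x \<in> C \<and> T (foldr h w x) = foldr g w (T x)" for w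
    by (induction w) (use h x in auto)
  have T_sum: "T (sum f S) = (\<Sum>w\<in>S. T (f w))" for f and S :: "uq_gen list set"
    by (induction S rule: infinite_finite_induct) (auto simp: assms(1,3))
  show ?thesis
    by (simp add: uq_eval_def T_sum assms(2) fold)
qed

section \<open>Modules given by operators satisfying the relations\<close>

locale uq_operators = vector_space s for s :: "'k::field \<Rightarrow> 'v::ab_group_add \<Rightarrow> 'v" +
  fixes q :: 'k and e f k kinv :: "'v \<Rightarrow> 'v"
  assumes q_nonzero [simp]: "q \<noteq> 0"
    and q_squared: "q\<^sup>2 \<noteq> 1"
    and linear_e: "Vector_Spaces.linear s s e"
    and linear_f: "Vector_Spaces.linear s s f"
    and linear_k: "Vector_Spaces.linear s s k"
    and linear_kinv: "Vector_Spaces.linear s s kinv"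
    and k_kinv [simp]: "k (kinv v) = v"
    and kinv_k [simp]: "kinv (k v) = v"
    and k_e: "k (e v) = s (q ^ 2) (e (k v))"
    and k_f: "k (f v) = s (inverse q ^ 2) (f (k v))"
    and e_f: "e (f v) - f (e v) = s (1 / (q - inverse q)) (k v - kinv v)"
begin

abbreviation ops :: "uq_gen \<Rightarrow> 'v \<Rightarrow> 'v" where "ops \<equiv> uq_ops e f k kinv"

abbreviation act :: "'k uq_free set \<Rightarrow> 'v \<Rightarrow> 'v" where "act \<equiv> uq_action s e f k kinv"

lemma linear_ops: "Vector_Spaces.linear s s (ops x)"
  by (cases x) (auto simp: uq_ops_def linear_e linear_f linear_k linear_kinv)

lemmas eval_linear = uq_eval_linear [OF vector_space_axioms linear_ops]

definition stable :: "'v set \<Rightarrow> bool" where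
  "stable W \<longleftrightarrow> subspace W \<and> e ` W \<subseteq> W \<and> f ` W \<subseteq> W \<and> k ` W \<subseteq> W \<and> kinv ` W \<subseteq> W"

lemma stable_ops: "stable W \<Longrightarrow> v \<in> W \<Longrightarrow> ops x v \<in> W"
  by (cases x) (auto simp: uq_ops_def stable_def)

lemma stable_subspace: "stable W \<Longrightarrow> subspace W"
  by (simp add: stable_def)

text \<open>
  The elements that evaluate to zero form an ideal, and the hypotheses on the
  operators say exactly that this ideal contains the relations.
\<close>

lemma eval_Uq_ideal:
  assumes "p \<in> Uq_ideal q"
  shows "uq_eval s ops p v = 0"
proof -
  let ?N = "{p \<in> carrier free_alg. \<forall>v. uq_eval s ops p v = 0}"
  note vs = vector_space_axioms
  have "ideal ?N free_alg"
  proof (rule idealI [OF ring_free_alg])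
    show "subgroup ?N (add_monoid free_alg)"
    proof (rule free_alg.add.subgroupI)
      show "?N \<noteq> {}"
        using free_alg.zero_closed by (auto simp: uq_eval_def intro!: exI [of _ 0])
      fix a assume a: "a \<in> ?N"
      have "\<ominus>\<^bsub>free_alg\<^esub> a = - a"
        by (rule free_alg.minus_equality) (use a in auto)
      moreover have "uq_eval s ops (0 - a) v = 0" for v
        by (subst uq_eval_diff [OF vs]) (use a in \<open>auto simp: uq_eval_def\<close>)
      ultimately show "\<ominus>\<^bsub>free_alg\<^esub> a \<in> ?N"
        using a by simp
    next
      fix a b assume "a \<in> ?N" "b \<in> ?N"
      then show "a \<oplus>\<^bsub>free_alg\<^esub> b \<in> ?N"
        using free_alg.a_closed [of a b] by (auto simp: uq_eval_add [OF vs])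
    qed auto
    fix a x :: "'k uq_free" assume a: "a \<in> ?N" and x: "x \<in> carrier free_alg"
    then show "x \<otimes>\<^bsub>free_alg\<^esub> a \<in> ?N" "a \<otimes>\<^bsub>free_alg\<^esub> x \<in> ?N"
      using free_alg.m_closed [of x a] free_alg.m_closed [of a x]
      by (auto simp: uq_eval_mult [OF vs linear_ops] eval_linear simp del: free_alg_simps)
  qed
  moreover have "uq_relations q \<subseteq> ?N"
  proof -
    have "uq_eval s ops r v = 0" if "r \<in> uq_relations q" for r v
      using that e_f [of v] k_e [of "kinv v"] k_f [of "kinv v"] unfolding uq_relations_def
      by (auto simp: uq_eval_diff [OF vs] finite_support_diff uq_eval_term [OF vs] uq_ops_def
          scale_right_diff_distrib simp del: fun_diff_def minus_apply)
    with uq_relations_subset show ?thesis by blast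
  qed
  ultimately have "Uq_ideal q \<subseteq> ?N"
    unfolding Uq_ideal_def by (rule free_alg.genideal_minimal)
  with assms show ?thesis by blast
qed

lemma eval_class_eq:
  assumes p: "p \<in> carrier free_alg" and r: "r \<in> Uq_class q p"
  shows "uq_eval s ops r v = uq_eval s ops p v"
proof -
  interpret ideal "Uq_ideal q" free_alg by (rule ideal_Uq_ideal)
  obtain h where h: "h \<in> Uq_ideal q" "r = h + p"
    using r by (auto simp: Uq_class_def a_r_coset_def')
  moreover have "h \<in> carrier free_alg" using h(1) a_subset by blast
  ultimately show ?thesis
    using p by (simp add: uq_eval_add [OF vector_space_axioms] eval_Uq_ideal)
qed

end

lemma Uq_class_self: "p \<in> carrier free_alg \<Longrightarrow> p \<in> Uq_class q p"
proof -
  interpret ideal "Uq_ideal q" free_alg by (rule ideal_Uq_ideal)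
  show "p \<in> carrier free_alg \<Longrightarrow> p \<in> Uq_class q p"
    unfolding Uq_class_def by (rule a_rcos_self)
qed

context uq_operators
begin

text \<open>
  The action is defined as the common value of a set of evaluations; by
  \<open>eval_class_eq\<close> that set is a singleton.
\<close>

lemma act_class:
  assumes p: "p \<in> carrier free_alg"
  shows "act (Uq_class q p) v = uq_eval s ops p v"
proof -
  have "(\<lambda>p. uq_eval s ops p v) ` Uq_class q p = {uq_eval s ops p v}"
    using image_cong [OF refl eval_class_eq [OF p]] image_constant [OF Uq_class_self [OF p]]
    by (rule trans)
  then show ?thesis by (simp add: uq_action_def)
qed

lemma act_ops: "act (Uq_class q (uq_term 1 [x])) v = ops x v"
  by (simp add: act_class uq_eval_term [OF vector_space_axioms])

lemma uq_module_stable: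
  assumes "stable C"
  shows "uq_module q s C act"
proof -
  note vs = vector_space_axioms
  note hom = Uq_class_ring_hom [of q]
  show ?thesis
    unfolding uq_module_def
  proof (intro conjI ballI allI)
    show "vector_space s" by (rule vs)
    show "subspace C" by (rule stable_subspace [OF assms])
    show "act x v \<in> C" if "x \<in> carrier (Uq q)" "v \<in> C" for x v
      using that uq_eval_closed [OF vs stable_subspace [OF assms], of ops, OF stable_ops [OF assms]]
      by (auto simp: carrier_Uq act_class simp del: free_alg_simps)
    show "act x (u + v) = act x u + act x v" if "x \<in> carrier (Uq q)" for x u v
      using that by (auto simp: carrier_Uq act_class eval_linear simp del: free_alg_simps)
    show "act x (s c v) = s c (act x v)" if "x \<in> carrier (Uq q)" for x c v
      using that by (auto simp: carrier_Uq act_class eval_linear simp del: free_alg_simps)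
    fix x y v assume "x \<in> carrier (Uq q)" "y \<in> carrier (Uq q)"
    then obtain p r where pr: "p \<in> carrier free_alg" "r \<in> carrier free_alg"
      and xy: "x = Uq_class q p" "y = Uq_class q r"
      by (auto simp: carrier_Uq simp del: free_alg_simps)
    show "act (x \<oplus>\<^bsub>Uq q\<^esub> y) v = act x v + act y v"
      unfolding xy ring_hom_add [OF hom pr, symmetric]
      using pr free_alg.a_closed [OF pr]
      by (simp only: act_class free_alg_simps(4) uq_eval_add [OF vs])
    show "act (x \<otimes>\<^bsub>Uq q\<^esub> y) v = act x (act y v)"
      unfolding xy ring_hom_mult [OF hom pr, symmetric]
      using pr free_alg.m_closed [OF pr]
      by (simp only: act_class uq_eval_mult [OF vs linear_ops])
  next
    show "act \<one>\<^bsub>Uq q\<^esub> v = v" for v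
      unfolding ring_hom_one [OF hom, symmetric]
      by (simp add: act_class uq_eval_term [OF vs])
    show "act (Uq_class q (uq_term c [])) v = s c v" for c v
      by (simp add: act_class uq_eval_term [OF vs])
  qed
qed

text \<open>
  From here on, submodules and irreducibility are handled through the four
  generators instead of the quotient algebra.
\<close>

lemma uq_submodule_iff_stable: "uq_submodule q s C act W \<longleftrightarrow> stable W \<and> W \<subseteq> C"
proof
  assume W: "uq_submodule q s C act W"
  have "ops x w \<in> W" if "w \<in> W" for x w
    using W that Uq_class_closed [of "uq_term 1 [x]" q]
    unfolding uq_submodule_def act_ops [symmetric] by simp
  from this [of _ Gen_e] this [of _ Gen_f] this [of _ Gen_k] this [of _ Gen_kinv]
  show "stable W \<and> W \<subseteq> C"
    using W by (auto simp: uq_ops_def stable_def uq_submodule_def)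
next
  assume "stable W \<and> W \<subseteq> C"
  then show "uq_submodule q s C act W"
    using uq_module_stable [of W] by (auto simp: uq_submodule_def uq_module_def)
qed

lemma uq_irreducible_iff_stable:
  assumes "stable C"
  shows "uq_irreducible q s C act \<longleftrightarrow> C \<noteq> {0} \<and> (\<forall>W. stable W \<and> W \<subseteq> C \<longrightarrow> W = {0} \<or> W = C)"
  using uq_module_stable [OF assms] by (auto simp: uq_irreducible_def uq_submodule_iff_stable)

end

section \<open>Highest weight vectors\<close>

definition qnum :: "'k::field \<Rightarrow> int \<Rightarrow> 'k" where
  "qnum q z = (q powi z - q powi (- z)) / (q - inverse q)"

lemma qint_eq_qnum: "q \<noteq> 0 \<Longrightarrow> qint q n = qnum q (int n)"
  by (simp add: qint_def qnum_def power_int_minus power_inverse)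

text \<open>
  The identity of \<open>q\<close>-integers that drives the induction in \<open>e_f_powers\<close>.
\<close>

lemma qnum_recurrence:
  assumes "q \<noteq> 0" "q\<^sup>2 \<noteq> 1"
  shows "qnum q (m + 1) * qnum q (n - m) = qnum q m * qnum q (n - m + 1) + qnum q (n - 2 * m)"
proof -
  define x y where "x = q powi m" and "y = q powi n"
  have xy: "x \<noteq> 0" "y \<noteq> 0" using assms by (auto simp: x_def y_def)
  have D: "q - inverse q \<noteq> 0"
    using assms by (simp add: field_simps power2_eq_square)
  have sq: "q powi (2 * m) = x * x"
    unfolding x_def mult_2 by (rule power_int_add) (use assms in simp)
  have eqs: "q powi (m + 1) = x * q" "q powi (- (m + 1)) = inverse (x * q)"
     "q powi (n - m) = y / x" "q powi (- (n - m)) = x / y"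
     "q powi m = x" "q powi (- m) = inverse x"
     "q powi (n - m + 1) = y / x * q" "q powi (- (n - m + 1)) = x / (y * q)"
     "q powi (n - 2 * m) = y / (x * x)" "q powi (- (n - 2 * m)) = x * x / y"
    using assms
    by (simp_all add: power_int_add power_int_diff power_int_minus sq divide_simps flip: x_def y_def)
  have "(x * q - inverse (x * q)) * (y / x - x / y) =
      (x - inverse x) * (y / x * q - x / (y * q)) + (y / (x * x) - x * x / y) * (q - inverse q)"
    using xy assms(1) by (simp add: field_simps)
  then show ?thesis
    unfolding qnum_def eqs using D by (simp add: divide_simps)
qed

context uq_operators
begin

lemma q_minus_inverse: "q - inverse q \<noteq> 0"
  using q_nonzero q_squared by (simp add: field_simps power2_eq_square)

lemmas e_simps = linear_map_simps [OF linear_e]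
lemmas f_simps = linear_map_simps [OF linear_f]
lemmas k_simps = linear_map_simps [OF linear_k]
lemmas kinv_simps = linear_map_simps [OF linear_kinv]

lemma kinv_eigenvector: "k v = s c v \<Longrightarrow> c \<noteq> 0 \<Longrightarrow> kinv v = s (inverse c) v"
  by (metis kinv_k kinv_simps(3) scale_scale left_inverse scale_one)

lemma k_f_powers:
  assumes "k u = s (q powi n) u"
  shows "k ((f ^^ m) u) = s (q powi (n - 2 * int m)) ((f ^^ m) u)"
proof (induction m)
  case (Suc m)
  have "q powi (n - 2 * int (Suc m)) = (inverse q)\<^sup>2 * q powi (n - 2 * int m)"
    using q_nonzero by (simp add: power_int_diff power_int_add power2_eq_square field_simps)
  then show ?case by (simp add: k_f Suc f_simps)
qed (use assms in simp)

text \<open>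
  The weight \<open>n\<close> is an arbitrary integer here.  In the classification of irreducible
  submodules the formula is applied to a vector whose weight is not yet known to be
  nonnegative.
\<close>

lemma e_f_powers:
  assumes "e u = 0" "k u = s (q powi n) u"
  shows "e ((f ^^ Suc m) u) = s (qnum q (int m + 1) * qnum q (n - int m)) ((f ^^ m) u)"
proof -
  have *: "e (f v) = f (e v) + s (qnum q z) v" if "k v = s (q powi z) v" for v z
  proof -
    have "kinv v = s (q powi (- z)) v"
      using kinv_eigenvector [OF that] by (simp add: power_int_minus)
    then have "e (f v) - f (e v) = s (qnum q z) v"
      using e_f [of v] that by (simp add: qnum_def scale_left_diff_distrib diff_divide_distrib scale_right_diff_distrib)
    then show ?thesis by (simp add: algebra_simps)
  qed
  show ?thesis
  proof (induction m)
    case 0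
    have "qnum q 1 = 1" using q_minus_inverse by (simp add: qnum_def power_int_minus)
    then show ?case using * [OF assms(2)] assms(1) by (simp add: f_simps)
  next
    case (Suc m)
    have "e ((f ^^ Suc (Suc m)) u) = f (e ((f ^^ Suc m) u)) + s (qnum q (n - 2 * int (Suc m))) ((f ^^ Suc m) u)"
      using * [OF k_f_powers [OF assms(2), of "Suc m"]] by simp
    also have "\<dots> = s (qnum q (int m + 1) * qnum q (n - int m) + qnum q (n - 2 * int (Suc m))) ((f ^^ Suc m) u)"
      unfolding Suc by (simp add: f_simps scale_left_distrib)
    also have "qnum q (int m + 1) * qnum q (n - int m) + qnum q (n - 2 * int (Suc m))
        = qnum q (int (Suc m) + 1) * qnum q (n - int (Suc m))"
      using qnum_recurrence [OF q_nonzero q_squared, of "int (Suc m)" n] by (simp add: algebra_simps)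
    finally show ?case .
  qed
qed

text \<open>
  The last condition is part of the notion because \<open>q\<close> may be a root of unity, where it
  does not follow from the others.
\<close>

definition highest_weight_vector :: "nat \<Rightarrow> 'v \<Rightarrow> bool" where
  "highest_weight_vector n u \<longleftrightarrow>
     u \<noteq> 0 \<and> e u = 0 \<and> k u = s (q powi int n) u \<and> (f ^^ Suc n) u = 0"

text \<open>
  These are the vectors that correspond to the basis of \<open>L(n, 1)\<close>.
\<close>

definition divided_power :: "nat \<Rightarrow> 'v \<Rightarrow> 'v" where
  "divided_power j u = s (inverse (\<Prod>l\<in>{1..j}. qint q l)) ((f ^^ j) u)"

definition string_map :: "nat \<Rightarrow> 'v \<Rightarrow> (nat \<Rightarrow> 'k) \<Rightarrow> 'v" where
  "string_map n u x = (\<Sum>j\<le>n. s (x j) (divided_power j u))"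

definition string_module :: "nat \<Rightarrow> 'v \<Rightarrow> 'v set" where
  "string_module n u = string_map n u ` L_carrier n"

lemma string_map_linear:
  "string_map n u (x + y) = string_map n u x + string_map n u y"
  "string_map n u (L_scale c x) = s c (string_map n u x)"
  "string_map n u 0 = 0"
  by (simp_all add: string_map_def L_scale_def sum.distrib scale_left_distrib scale_sum_right)

lemma string_map_sum: "string_map n u (sum g S) = (\<Sum>i\<in>S. string_map n u (g i))"
  by (induction S rule: infinite_finite_induct)
     (simp_all only: string_map_linear sum.infinite sum.empty sum.insert not_False_eq_True)

lemma string_map_basis: "j \<le> n \<Longrightarrow> string_map n u (L_basis j) = divided_power j u"
proof -
  assume "j \<le> n"
  have "string_map n u (L_basis j) = (\<Sum>i\<le>n. if i = j then divided_power j u else 0)"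
    unfolding string_map_def by (intro sum.cong) (auto simp: L_basis_def)
  then show ?thesis using \<open>j \<le> n\<close> by simp
qed

end

lemma L_carrier_closed:
  "0 \<in> L_carrier n"
  "x \<in> L_carrier n \<Longrightarrow> y \<in> L_carrier n \<Longrightarrow> x + y \<in> L_carrier n"
  "x \<in> L_carrier n \<Longrightarrow> L_scale c x \<in> L_carrier n"
  "j \<le> n \<Longrightarrow> L_basis j \<in> L_carrier n"
  by (auto simp: L_carrier_def L_scale_def L_basis_def)

lemma L_carrier_sum: "(\<And>i. i \<in> S \<Longrightarrow> g i \<in> L_carrier n) \<Longrightarrow> sum g S \<in> L_carrier n"
  by (induction S rule: infinite_finite_induct) (auto intro: L_carrier_closed simp del: plus_fun_apply)

text \<open>
  The operators send arbitrary sequences into \<open>L(n, c)\<close>, since each is a combination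
  of the basis vectors with index at most \<open>n\<close>.
\<close>

lemma L_ops_closed: "uq_ops (L_e q n c) (L_f q n) (L_k q n c) (L_kinv q n c) y x \<in> L_carrier n"
  by (cases y) (auto simp: uq_ops_def L_e_def L_f_def L_k_def L_kinv_def intro!: L_carrier_sum L_carrier_closed)

context uq_operators
begin

context
  fixes n :: nat and u :: 'v
  assumes hw: "highest_weight_vector n u"
    and qint_nonzero: "\<And>j. 1 \<le> j \<Longrightarrow> j \<le> n \<Longrightarrow> qint q j \<noteq> 0"
begin

lemma hw_simps: "u \<noteq> 0" "e u = 0" "k u = s (q powi int n) u" "(f ^^ Suc n) u = 0"
  using hw by (auto simp: highest_weight_vector_def)

lemma divided_power_0: "divided_power 0 u = u"
  by (simp add: divided_power_def)

lemma f_divided_power: "j < n \<Longrightarrow> f (divided_power j u) = s (qint q (Suc j)) (divided_power (Suc j) u)"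
  using qint_nonzero [of "Suc j"] by (simp add: divided_power_def f_simps)

lemma f_divided_power_last: "f (divided_power n u) = 0"
  using hw_simps(4) by (simp add: divided_power_def f_simps)

lemma k_divided_power: "k (divided_power j u) = s (q powi (int n - 2 * int j)) (divided_power j u)"
  using k_f_powers [OF hw_simps(3), of j] by (simp add: divided_power_def k_simps mult.commute)

lemma kinv_divided_power:
  "kinv (divided_power j u) = s (inverse (q powi (int n - 2 * int j))) (divided_power j u)"
  by (rule kinv_eigenvector [OF k_divided_power]) simp

text \<open>
  Passing from powers to divided powers trades the factor \<open>[j + 1] [n - j]\<close> for
  \<open>[n - j]\<close>, the coefficient in \<open>L(n, 1)\<close>.
\<close>

lemma e_divided_power:
  assumes "j < n"
  shows "e (divided_power (Suc j) u) = s (qint q (n - j)) (divided_power j u)"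
proof -
  have "qnum q (int j + 1) = qint q (Suc j)" "qnum q (int n - int j) = qint q (n - j)"
    using assms by (simp_all add: qint_eq_qnum of_nat_diff add.commute)
  moreover have "qint q (Suc j) \<noteq> 0" by (rule qint_nonzero) (use assms in auto)
  ultimately show ?thesis
    unfolding divided_power_def using e_f_powers [OF hw_simps(2,3), of j]
    by (simp add: e_simps del: funpow.simps)
qed

lemma string_map_e: "e (string_map n u x) = string_map n u (L_e q n 1 x)"
proof -
  have "e (string_map n u x) = (\<Sum>j\<le>n. s (x j) (e (divided_power j u)))"
    by (simp add: string_map_def e_simps)
  also have "\<dots> = (\<Sum>j=1..n. s (x j) (e (divided_power j u)))"
    by (rule sum.mono_neutral_right) (auto simp: divided_power_0 hw_simps not_le)
  also have "\<dots> = (\<Sum>j=1..n. s (x j) (s (1 * qint q (n + 1 - j)) (string_map n u (L_basis (j - 1)))))"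
  proof (rule sum.cong [OF refl])
    fix j assume j: "j \<in> {1..n}"
    then obtain i where i: "j = Suc i" "i < n" by (cases j) auto
    show "s (x j) (e (divided_power j u)) =
        s (x j) (s (1 * qint q (n + 1 - j)) (string_map n u (L_basis (j - 1))))"
      using i by (simp add: e_divided_power string_map_basis)
  qed
  also have "\<dots> = string_map n u (L_e q n 1 x)"
    by (simp only: L_e_def string_map_sum string_map_linear)
  finally show ?thesis .
qed

lemma string_map_f: "f (string_map n u x) = string_map n u (L_f q n x)"
proof -
  have "f (string_map n u x) = (\<Sum>j\<le>n. s (x j) (f (divided_power j u)))"
    by (simp add: string_map_def f_simps)
  also have "\<dots> = (\<Sum>j<n. s (x j) (f (divided_power j u)))"
    by (simp add: f_divided_power_last flip: lessThan_Suc_atMost)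
  also have "\<dots> = (\<Sum>j<n. s (x j) (s (qint q (j + 1)) (string_map n u (L_basis (j + 1)))))"
    by (rule sum.cong [OF refl]) (simp add: f_divided_power string_map_basis)
  also have "\<dots> = string_map n u (L_f q n x)"
    by (simp only: L_f_def string_map_sum string_map_linear)
  finally show ?thesis .
qed

lemma string_map_k: "k (string_map n u x) = string_map n u (L_k q n 1 x)"
proof -
  have "k (string_map n u x) = (\<Sum>j\<le>n. s (x j) (k (divided_power j u)))"
    by (simp add: string_map_def k_simps)
  also have "\<dots> = (\<Sum>j\<le>n. s (x j) (s (1 * q powi (int n - 2 * int j)) (string_map n u (L_basis j))))"
    by (rule sum.cong [OF refl]) (simp add: k_divided_power string_map_basis)
  also have "\<dots> = string_map n u (L_k q n 1 x)"
    by (simp only: L_k_def string_map_sum string_map_linear)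
  finally show ?thesis .
qed

lemma string_map_kinv: "kinv (string_map n u x) = string_map n u (L_kinv q n 1 x)"
proof -
  have "kinv (string_map n u x) = (\<Sum>j\<le>n. s (x j) (kinv (divided_power j u)))"
    by (simp add: string_map_def kinv_simps)
  also have "\<dots> = (\<Sum>j\<le>n. s (x j) (s (inverse (1 * q powi (int n - 2 * int j))) (string_map n u (L_basis j))))"
    by (rule sum.cong [OF refl]) (simp add: kinv_divided_power string_map_basis)
  also have "\<dots> = string_map n u (L_kinv q n 1 x)"
    by (simp only: L_kinv_def string_map_sum string_map_linear)
  finally show ?thesis .
qed

text \<open>
  Together the four computations say that the string map is a homomorphism from
  \<open>L(n, 1)\<close>.
\<close>

lemma string_map_ops:
  "string_map n u (uq_ops (L_e q n 1) (L_f q n) (L_k q n 1) (L_kinv q n 1) y x) = ops y (string_map n u x)"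
  by (cases y) (auto simp: uq_ops_def string_map_e string_map_f string_map_k string_map_kinv)

lemma stable_string_module: "stable (string_module n u)"
proof -
  have "ops y (string_map n u x) \<in> string_module n u" for x y
    unfolding string_module_def string_map_ops [symmetric] by (intro imageI L_ops_closed)
  from this [of Gen_e] this [of Gen_f] this [of Gen_k] this [of Gen_kinv]
  have "e ` string_module n u \<subseteq> string_module n u" "f ` string_module n u \<subseteq> string_module n u"
    "k ` string_module n u \<subseteq> string_module n u" "kinv ` string_module n u \<subseteq> string_module n u"
    by (auto simp: uq_ops_def) (auto simp: string_module_def)
  moreover have "subspace (string_module n u)"
    unfolding string_module_def
  proof (rule subspaceI)
    show "0 \<in> string_map n u ` L_carrier n"
      using L_carrier_closed(1) string_map_linear(3) by (metis imageI)
    fix v w c assume "v \<in> string_map n u ` L_carrier n"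
    then obtain x where x: "x \<in> L_carrier n" "v = string_map n u x" by auto
    then show "s c v \<in> string_map n u ` L_carrier n"
      using L_carrier_closed(3) string_map_linear(2) by (metis imageI)
    assume "w \<in> string_map n u ` L_carrier n"
    then obtain y where y: "y \<in> L_carrier n" "w = string_map n u y" by auto
    have "v + w = string_map n u (x + y)"
      by (simp only: x y string_map_linear)
    moreover have "x + y \<in> L_carrier n"
      by (intro L_carrier_closed x y)
    ultimately show "v + w \<in> string_map n u ` L_carrier n"
      by (metis imageI)
  qed
  ultimately show ?thesis by (simp add: stable_def)
qed

lemma generator_mem_string_module: "u \<in> string_module n u"
  using string_map_basis [of 0 n u] L_carrier_closed(4) [of 0 n]
  by (metis divided_power_0 imageI le0 string_module_def)

text \<open>
  Applying \<open>e\<close> lowers the top index \<open>J\<close> by one and multiplies the top coefficient by a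
  nonzero \<open>q\<close>-integer, so \<open>J\<close> applications leave a nonzero multiple of \<open>u\<close>.
\<close>

lemma generator_mem_if_combination_mem:
  assumes "stable W" "J \<le> n" "c J \<noteq> 0" "(\<Sum>j\<le>J. s (c j) (divided_power j u)) \<in> W"
  shows "u \<in> W"
  using assms(2-4)
proof (induction J arbitrary: c)
  case 0
  then have "s (inverse (c 0)) (s (c 0) u) \<in> W"
    using stable_subspace [OF assms(1)] by (simp only: subspace_scale divided_power_0 atMost_0 sum.insert sum.empty finite.emptyI empty_iff not_False_eq_True add_0_right)
  then show ?case using 0 by simp
next
  case (Suc J)
  let ?c = "\<lambda>j. c (Suc j) * qint q (n - j)"
  have "e (\<Sum>j\<le>Suc J. s (c j) (divided_power j u)) = (\<Sum>j\<le>J. s (?c j) (divided_power j u))"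
    using Suc.prems(1)
    by (simp add: sum.atMost_Suc_shift e_simps e_divided_power divided_power_0 hw_simps del: sum.atMost_Suc)
  moreover have "e (\<Sum>j\<le>Suc J. s (c j) (divided_power j u)) \<in> W"
    using assms(1) Suc.prems(3) by (auto simp: stable_def)
  moreover have "?c J \<noteq> 0"
    using Suc.prems qint_nonzero [of "n - J"] by simp
  ultimately show ?case
    using Suc.IH [of ?c] Suc.prems(1) by simp
qed

lemma generator_mem_if_string_map_mem:
  assumes "stable W" "x \<in> L_carrier n" "x \<noteq> 0" "string_map n u x \<in> W"
  shows "u \<in> W"
proof -
  let ?N = "{j. x j \<noteq> 0}"
  have sub: "?N \<subseteq> {..n}" using assms(2) by (auto simp: L_carrier_def not_le [symmetric])
  then have fin: "finite ?N" by (rule finite_subset) simp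
  have ne: "?N \<noteq> {}" using assms(3) by (auto simp: fun_eq_iff)
  define J where "J = Max ?N"
  have J: "x J \<noteq> 0" "J \<le> n"
    using Max_in [OF fin ne] sub by (auto simp: J_def)
  have "x j = 0" if "j > J" for j
    using Max_ge [OF fin, of j] that by (auto simp: J_def)
  then have "string_map n u x = (\<Sum>j\<le>J. s (x j) (divided_power j u))"
    unfolding string_map_def by (intro sum.mono_neutral_right) (use J in auto)
  then show ?thesis using generator_mem_if_combination_mem [OF assms(1), of J x] J assms(4) by simp
qed

text \<open>
  Injectivity is the case \<open>W = {0}\<close> of \<open>generator_mem_if_string_map_mem\<close>: a nonzero
  sequence in the kernel would put \<open>u\<close> into \<open>{0}\<close>.
\<close>

lemma string_map_eq_0_iff:
  assumes "x \<in> L_carrier n" "string_map n u x = 0"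
  shows "x = 0"
proof (rule ccontr)
  assume "x \<noteq> 0"
  have "stable {0}" by (simp add: stable_def e_simps f_simps k_simps kinv_simps)
  then show False
    using generator_mem_if_string_map_mem [OF _ assms(1) \<open>x \<noteq> 0\<close>] assms(2) hw_simps(1) by auto
qed

lemma bij_betw_string_map: "bij_betw (string_map n u) (L_carrier n) (string_module n u)"
  unfolding bij_betw_def string_module_def
proof (intro conjI inj_onI refl)
  fix x y assume xy: "x \<in> L_carrier n" "y \<in> L_carrier n" "string_map n u x = string_map n u y"
  let ?z = "x + L_scale (- 1) y"
  have "?z \<in> L_carrier n" using xy by (intro L_carrier_closed)
  moreover have "string_map n u ?z = 0" using xy by (simp only: string_map_linear) simp
  ultimately have "?z = 0" by (rule string_map_eq_0_iff)
  then show "x = y" by (auto simp: fun_eq_iff L_scale_def)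
qed

lemma string_module_subset_stable:
  assumes "stable W" "u \<in> W"
  shows "string_module n u \<subseteq> W"
proof -
  have "(f ^^ j) u \<in> W" for j
    by (induction j) (use assms in \<open>auto simp: stable_def\<close>)
  then have "divided_power j u \<in> W" for j
    unfolding divided_power_def using stable_subspace [OF assms(1)] by (intro subspace_scale)
  then show ?thesis
    using stable_subspace [OF assms(1)]
    by (auto simp: string_module_def string_map_def intro!: subspace_sum subspace_scale)
qed

lemma irreducible_string_module: "uq_irreducible q s (string_module n u) act"
  unfolding uq_irreducible_iff_stable [OF stable_string_module]
proof (intro conjI allI impI)
  show "string_module n u \<noteq> {0}"
    using generator_mem_string_module hw_simps(1) by blast
  fix W assume W: "stable W \<and> W \<subseteq> string_module n u"
  show "W = {0} \<or> W = string_module n u"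
  proof (cases "W \<subseteq> {0}")
    case True
    then show ?thesis using W subspace_0 [OF stable_subspace] by blast
  next
    case False
    then obtain w where w: "w \<in> W" "w \<noteq> 0" by auto
    then obtain x where x: "x \<in> L_carrier n" "w = string_map n u x"
      using W by (auto simp: string_module_def)
    have "x \<noteq> 0" using w x string_map_linear(3) by metis
    then have "u \<in> W" using generator_mem_if_string_map_mem x w W by blast
    then show ?thesis using string_module_subset_stable W by blast
  qed
qed

text \<open>
  The isomorphism is the inverse of the string map.  All members of a coset act alike
  on \<open>V\<close>, and injectivity of the string map transports this to \<open>L(n, 1)\<close>.
\<close>

lemma isomorphic_string_module:
  "uq_isomorphic q s (string_module n u) act L_scale (L_carrier n) (L_action q n 1)"
proof -
  let ?M = "string_module n u" and ?T = "string_map n u"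
  let ?Lops = "uq_ops (L_e q n 1) (L_f q n) (L_k q n 1) (L_kinv q n 1)"
  define \<phi> where "\<phi> = inv_into (L_carrier n) ?T"
  note bij = bij_betw_string_map
  have \<phi>_T: "\<phi> (?T x) = x" if "x \<in> L_carrier n" for x
    using bij that by (simp add: \<phi>_def bij_betw_inv_into_left)
  have M: "\<exists>x\<in>L_carrier n. v = ?T x" if "v \<in> ?M" for v
    using that by (auto simp: string_module_def)
  show ?thesis
    unfolding uq_isomorphic_def
  proof (intro exI [of _ \<phi>] conjI ballI allI)
    show "bij_betw \<phi> ?M (L_carrier n)"
      unfolding \<phi>_def by (rule bij_betw_inv_into [OF bij])
    show "\<phi> (v + w) = \<phi> v + \<phi> w" if "v \<in> ?M" "w \<in> ?M" for v w
      using M [OF that(1)] M [OF that(2)] by (metis \<phi>_T string_map_linear(1) L_carrier_closed(2))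
    show "\<phi> (s c v) = L_scale c (\<phi> v)" if "v \<in> ?M" for c v
      using M [OF that] by (metis \<phi>_T string_map_linear(2) L_carrier_closed(3))
    fix X v assume X: "X \<in> carrier (Uq q)" and v: "v \<in> ?M"
    obtain x where x: "x \<in> L_carrier n" "v = ?T x" using M [OF v] by blast
    have closed: "uq_eval L_scale ?Lops p x \<in> L_carrier n" for p
    proof -
      have "foldr ?Lops w x \<in> L_carrier n" for w
        by (cases w) (auto simp: x L_ops_closed)
      then show ?thesis
        unfolding uq_eval_def by (intro L_carrier_sum L_carrier_closed)
    qed
    have T_eval: "?T (uq_eval L_scale ?Lops p x) = uq_eval s ops p v" for p
      unfolding x(2)
      by (rule uq_eval_intertwine [where C = "L_carrier n"])
         (simp_all only: string_map_linear L_ops_closed string_map_ops x simp_thms)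
    obtain p where p: "p \<in> carrier free_alg" "X = Uq_class q p"
      using X by (auto simp: carrier_Uq simp del: free_alg_simps)
    have const: "uq_eval L_scale ?Lops r x = uq_eval L_scale ?Lops p x" if r: "r \<in> X" for r
    proof -
      have "?T (uq_eval L_scale ?Lops r x) = ?T (uq_eval L_scale ?Lops p x)"
        unfolding T_eval using eval_class_eq [OF p(1)] r p(2) by blast
      then show ?thesis using closed \<phi>_T by metis
    qed
    have "p \<in> X"
      unfolding p(2) by (rule Uq_class_self [OF p(1)])
    have "(\<lambda>r. uq_eval L_scale ?Lops r x) ` X = {uq_eval L_scale ?Lops p x}"
      using image_cong [OF refl const] image_constant [OF \<open>p \<in> X\<close>] by (rule trans)
    then have "L_action q n 1 X x = uq_eval L_scale ?Lops p x"
      by (simp add: L_action_def uq_action_def)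
    also have "\<dots> = \<phi> (uq_eval s ops p v)"
      unfolding T_eval [symmetric] by (rule \<phi>_T [OF closed, symmetric])
    also have "\<dots> = \<phi> (act X v)"
      using p by (simp only: act_class)
    finally show "\<phi> (act X v) = L_action q n 1 X (\<phi> v)"
      using x \<phi>_T by simp
  qed
qed

end

end

section \<open>A criterion for semisimplicity\<close>

locale finite_dimensional_uq_operators =
  uq_operators s q e f k kinv + finite_dimensional_vector_space s Basis
  for s :: "'k::field \<Rightarrow> 'v::ab_group_add \<Rightarrow> 'v" and q :: 'k
    and e f k kinv :: "'v \<Rightarrow> 'v" and Basis :: "'v set"
begin

text \<open>
  Directness is stated as independence of the summands, which is easier to extend by a
  summand than uniqueness of the decomposition.
\<close>

definition direct_irreducible_sum :: "nat \<Rightarrow> (nat \<Rightarrow> 'v set) \<Rightarrow> 'v set \<Rightarrow> bool" where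
  "direct_irreducible_sum m W S \<longleftrightarrow>
     (\<forall>j<m. stable (W j) \<and> uq_irreducible q s (W j) act) \<and>
     S = subspace_sum {..<m} W \<and>
     (\<forall>w. (\<forall>j<m. w j \<in> W j) \<longrightarrow> (\<Sum>j<m. w j) = 0 \<longrightarrow> (\<forall>j<m. w j = 0))"

lemma stable_sums:
  assumes "stable S" "stable M"
  shows "stable {x + y | x y. x \<in> S \<and> y \<in> M}"
proof -
  have sums: "h ` {x + y | x y. x \<in> S \<and> y \<in> M} \<subseteq> {x + y | x y. x \<in> S \<and> y \<in> M}"
    if "Vector_Spaces.linear s s h" "h ` S \<subseteq> S" "h ` M \<subseteq> M" for h
    using that(2,3) by (auto simp: linear_map_add [OF that(1)]) blast
  have "subspace {x + y |x y. x \<in> S \<and> y \<in> M}"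
    using assms by (intro subspace_sums stable_subspace)
  then show ?thesis
    using assms sums [OF linear_e] sums [OF linear_f] sums [OF linear_k] sums [OF linear_kinv]
    by (simp add: stable_def)
qed

lemma stable_Int: "stable S \<Longrightarrow> stable M \<Longrightarrow> stable (S \<inter> M)"
  by (auto simp: stable_def subspace_inter)

lemma direct_irreducible_sum_extend:
  assumes S: "direct_irreducible_sum m W S" "stable S"
    and M: "stable M" "uq_irreducible q s M act" "S \<inter> M = {0}"
  shows "direct_irreducible_sum (Suc m) (W(m := M)) {x + y | x y. x \<in> S \<and> y \<in> M}"
proof -
  have S_eq: "S = {\<Sum>j<m. w j |w. \<forall>j<m. w j \<in> W j}"
    using S by (auto simp: direct_irreducible_sum_def subspace_sum_def)
  have "\<exists>w. (\<forall>j<Suc m. w j \<in> (W(m := M)) j) \<and> x + y = (\<Sum>j<Suc m. w j)"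
    if x: "x \<in> S" and y: "y \<in> M" for x y
  proof -
    obtain w where w: "\<forall>j<m. w j \<in> W j" "x = (\<Sum>j<m. w j)"
      using x unfolding S_eq by auto
    have "x + y = (\<Sum>j<Suc m. (w(m := y)) j)" by (simp add: w)
    then show ?thesis using w y by (intro exI [of _ "w(m := y)"]) auto
  qed
  moreover have "\<exists>x y. (\<Sum>j<Suc m. w j) = x + y \<and> x \<in> S \<and> y \<in> M"
    if w: "\<forall>j<Suc m. w j \<in> (W(m := M)) j" for w
  proof (intro exI conjI)
    show "(\<Sum>j<Suc m. w j) = (\<Sum>j<m. w j) + w m" by simp
    have "\<forall>j<m. w j \<in> W j" using w by (metis fun_upd_other less_SucI less_irrefl_nat)
    then show "(\<Sum>j<m. w j) \<in> S" unfolding S_eq by blast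
    show "w m \<in> M" using w by (metis fun_upd_same lessI)
  qed
  ultimately have "{x + y | x y. x \<in> S \<and> y \<in> M} = subspace_sum {..<Suc m} (W(m := M))"
    unfolding subspace_sum_def by (auto simp del: fun_upd_apply sum.lessThan_Suc) blast+
  moreover have "\<forall>j<Suc m. w j = 0"
    if w: "\<forall>j<Suc m. w j \<in> (W(m := M)) j" "(\<Sum>j<Suc m. w j) = 0" for w
  proof -
    have wW: "\<forall>j<m. w j \<in> W j" using w(1) by (metis fun_upd_other less_SucI less_irrefl_nat)
    have "w m = - (\<Sum>j<m. w j)" using w(2) by (simp add: eq_neg_iff_add_eq_0 add.commute)
    moreover have "(\<Sum>j<m. w j) \<in> S" using wW unfolding S_eq by blast
    ultimately have "w m \<in> S" using subspace_neg [OF stable_subspace [OF S(2)]] by simp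
    moreover have "w m \<in> M" using w(1) by (metis fun_upd_same lessI)
    ultimately have wm: "w m = 0" using M(3) by blast
    then have "(\<Sum>j<m. w j) = 0" using w(2) by simp
    then have "\<forall>j<m. w j = 0"
      using wW S(1) unfolding direct_irreducible_sum_def by blast
    with wm show ?thesis by (simp add: less_Suc_eq)
  qed
  ultimately show ?thesis
    using S(1) M unfolding direct_irreducible_sum_def by auto
qed

lemma semisimple_direct_irreducible_sum:
  assumes "direct_irreducible_sum m W UNIV"
  shows "uq_semisimple q s UNIV act"
  unfolding uq_semisimple_def
proof (intro conjI exI [of _ m] exI [of _ W])
  have st: "stable UNIV" by (simp add: stable_def)
  then show "uq_module q s UNIV act" by (rule uq_module_stable)
  show "\<forall>j<m. uq_submodule q s UNIV act (W j) \<and> uq_irreducible q s (W j) act"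
    using assms by (simp add: direct_irreducible_sum_def uq_submodule_iff_stable)
  have ind: "\<And>w. \<forall>j<m. w j \<in> W j \<Longrightarrow> (\<Sum>j<m. w j) = 0 \<Longrightarrow> \<forall>j<m. w j = 0"
    using assms by (simp add: direct_irreducible_sum_def)
  show "is_direct_sum UNIV {..<m} W"
    unfolding is_direct_sum_def
  proof (intro conjI ballI)
    fix v :: 'v
    have "v \<in> subspace_sum {..<m} W" using assms by (simp add: direct_irreducible_sum_def)
    then obtain w where w: "\<forall>j<m. w j \<in> W j" "v = (\<Sum>j<m. w j)"
      by (auto simp: subspace_sum_def)
    show "\<exists>!w. w \<in> Pi\<^sub>E {..<m} W \<and> v = sum w {..<m}"
    proof (rule ex1I [of _ "restrict w {..<m}"])
      show "restrict w {..<m} \<in> Pi\<^sub>E {..<m} W \<and> v = sum (restrict w {..<m}) {..<m}"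
        using w by auto
      fix w' assume w': "w' \<in> Pi\<^sub>E {..<m} W \<and> v = sum w' {..<m}"
      have "w' j - w j \<in> W j" if "j < m" for j
      proof -
        have "subspace (W j)"
          using assms that stable_subspace by (simp add: direct_irreducible_sum_def)
        moreover have "w' j \<in> W j" using w' that by (meson PiE_mem lessThan_iff)
        moreover have "w j \<in> W j" using w that by simp
        ultimately show ?thesis by (rule subspace_diff)
      qed
      moreover have "(\<Sum>j<m. w' j - w j) = 0" using w w' by (simp add: sum_subtractf)
      ultimately have "\<forall>j<m. w' j - w j = 0"
        using ind [of "\<lambda>j. w' j - w j"] by blast
      then show "w' = restrict w {..<m}"
        using w' by (intro ext) (simp add: PiE_def extensional_def)
    qed
  qed simp
qed

text \<open>
  Take a direct sum \<open>S\<close> of irreducible submodules of the largest possible dimension.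
  If an irreducible \<open>M\<close> is not contained in \<open>S\<close>, then \<open>S \<inter> M\<close> is a proper submodule of
  \<open>M\<close>, hence zero, and \<open>S + M\<close> is a larger direct sum.
\<close>

lemma semisimple_if_irreducibles_exhaust:
  assumes irr: "\<And>S. stable S \<Longrightarrow> S \<noteq> UNIV \<Longrightarrow>
    \<exists>M. stable M \<and> uq_irreducible q s M act \<and> \<not> M \<subseteq> S"
  shows "uq_semisimple q s UNIV act"
proof -
  let ?P = "\<lambda>S. stable S \<and> (\<exists>m W. direct_irreducible_sum m W S)"
  have "?P {0}"
    by (auto simp: stable_def e_simps f_simps k_simps kinv_simps direct_irreducible_sum_def
        subspace_sum_def intro!: exI [of _ 0])
  moreover have "\<forall>T. ?P T \<longrightarrow> dim T < Suc dimension"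
    using dim_subset_UNIV by (simp add: less_Suc_eq_le)
  ultimately have "\<exists>S. ?P S \<and> (\<forall>T. ?P T \<longrightarrow> dim T \<le> dim S)"
    by (rule ex_has_greatest_nat)
  then obtain S m W where S: "stable S" "direct_irreducible_sum m W S"
    and max: "\<And>T. ?P T \<Longrightarrow> dim T \<le> dim S"
    by blast
  have "S = UNIV"
  proof (rule ccontr)
    assume "S \<noteq> UNIV"
    then obtain M where M: "stable M" "uq_irreducible q s M act" "\<not> M \<subseteq> S"
      using irr [OF S(1)] by blast
    have SM: "S \<inter> M = {0}"
      using M S(1) stable_Int [OF S(1) M(1)] unfolding uq_irreducible_iff_stable [OF M(1)] by blast
    let ?T = "{x + y | x y. x \<in> S \<and> y \<in> M}"
    have T: "stable ?T" by (rule stable_sums [OF S(1) M(1)])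
    have z: "0 \<in> S" "0 \<in> M" using S(1) M(1) by (auto intro: subspace_0 stable_subspace)
    have "x = x + 0" "x = 0 + x" for x :: 'v by simp_all
    then have "S \<subseteq> ?T" "M \<subseteq> ?T" using z by blast+
    then have "S \<subset> ?T" using M(3) by blast
    moreover have "span S = S" "span ?T = ?T"
      using S(1) T by (simp_all add: span_eq_iff stable_subspace)
    ultimately have "dim S < dim ?T" by (intro dim_psubset) (simp only:)
    moreover have "?P ?T"
      using T direct_irreducible_sum_extend [OF S(2,1) M(1,2) SM] by blast
    ultimately show False using max [of ?T] by simp
  qed
  then show ?thesis using semisimple_direct_irreducible_sum S by blast
qed

end

section \<open>Diagonalizable maps through their primitive idempotents\<close>

lemma (in vector_space) span_UN_subspaces:
  assumes "finite I" "\<And>i. i \<in> I \<Longrightarrow> subspace (U i)" "v \<in> span (\<Union>i\<in>I. U i)"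
  obtains u where "\<And>i. i \<in> I \<Longrightarrow> u i \<in> U i" "v = (\<Sum>i\<in>I. u i)"
proof -
  let ?T = "{v. \<exists>u. (\<forall>i\<in>I. u i \<in> U i) \<and> v = (\<Sum>i\<in>I. u i)}"
  have "subspace ?T"
  proof (rule subspaceI)
    show "0 \<in> ?T" using assms(2) by (auto intro!: exI [of _ "\<lambda>_. 0"] subspace_0)
    fix x y c assume "x \<in> ?T"
    then obtain u where u: "\<forall>i\<in>I. u i \<in> U i" "x = (\<Sum>i\<in>I. u i)" by blast
    then have "\<forall>i\<in>I. scale c (u i) \<in> U i" using assms(2) by (simp add: subspace_scale)
    then show "scale c x \<in> ?T"
      using u by (intro CollectI exI [of _ "\<lambda>i. scale c (u i)"]) (simp add: scale_sum_right)
    assume "y \<in> ?T"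
    then obtain w where w: "\<forall>i\<in>I. w i \<in> U i" "y = (\<Sum>i\<in>I. w i)" by blast
    have "\<forall>i\<in>I. u i + w i \<in> U i" using u w assms(2) by (simp add: subspace_add)
    then show "x + y \<in> ?T"
      using u w by (intro CollectI exI [of _ "\<lambda>i. u i + w i"]) (simp add: sum.distrib)
  qed
  moreover have "(\<Union>i\<in>I. U i) \<subseteq> ?T"
  proof
    fix x assume "x \<in> (\<Union>i\<in>I. U i)"
    then obtain j where j: "j \<in> I" "x \<in> U j" by blast
    have "x = (\<Sum>i\<in>I. if i = j then x else 0)" using assms(1) j by simp
    moreover have "\<forall>i\<in>I. (if i = j then x else 0) \<in> U i" using assms(2) j by (auto intro: subspace_0)
    ultimately show "x \<in> ?T" by (intro CollectI exI [of _ "\<lambda>i. if i = j then x else 0"]) blast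
  qed
  ultimately have "span (\<Union>i\<in>I. U i) \<subseteq> ?T" by (intro span_minimal)
  then show ?thesis using assms(3) that by auto
qed

text \<open>
  A diagonalizable map with its primitive idempotents, in a form of which both members of a
  tridiagonal pair and both orderings of the idempotents are instances.
\<close>

locale diagonal_map = vector_space s
  for s :: "'k::field \<Rightarrow> 'v::ab_group_add \<Rightarrow> 'v" +
  fixes d :: nat and A :: "'v \<Rightarrow> 'v" and E :: "nat \<Rightarrow> 'v \<Rightarrow> 'v" and \<theta> :: "nat \<Rightarrow> 'k"
  assumes linear_A: "Vector_Spaces.linear s s A"
    and linear_E: "i \<le> d \<Longrightarrow> Vector_Spaces.linear s s (E i)"
    and E_E: "i \<le> d \<Longrightarrow> j \<le> d \<Longrightarrow> E i (E j v) = (if i = j then E i v else 0)"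
    and sum_E: "(\<Sum>i\<le>d. E i v) = v"
    and A_E: "i \<le> d \<Longrightarrow> A (E i v) = s (\<theta> i) (E i v)"
    and inj_eigenvalues: "inj_on \<theta> {..d}"
    and E_nonzero: "i \<le> d \<Longrightarrow> \<exists>v. E i v \<noteq> 0"
begin

lemmas A_simps = linear_map_simps [OF linear_A]
lemmas E_simps = linear_map_simps [OF linear_E]

lemma E_A:
  assumes "i \<le> d"
  shows "E i (A v) = s (\<theta> i) (E i v)"
proof -
  have "E i (A v) = E i (A (\<Sum>j\<le>d. E j v))" by (simp add: sum_E)
  also have "\<dots> = (\<Sum>j\<le>d. if i = j then s (\<theta> i) (E i v) else 0)"
    unfolding A_simps E_simps [OF assms] using assms
    by (intro sum.cong refl) (auto simp: A_E E_E E_simps)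
  also have "\<dots> = s (\<theta> i) (E i v)" using assms by simp
  finally show ?thesis .
qed

text \<open>
  For \<open>J \<subseteq> {0..d}\<close> this is the sum of the eigenspaces \<open>E j V\<close> with \<open>j \<in> J\<close> (see
  \<open>subspace_sum_range_E\<close>).  In this form indices beyond \<open>d\<close> are harmless, so half-infinite
  index sets can be used and the ends of the range need no separate treatment.
\<close>

definition eigen_sum :: "nat set \<Rightarrow> 'v set" where
  "eigen_sum J = {v. \<forall>i\<le>d. i \<notin> J \<longrightarrow> E i v = 0}"

lemma subspace_eigen_sum: "subspace (eigen_sum J)"
  by (rule subspaceI) (auto simp: eigen_sum_def E_simps)

lemma eigen_sum_mono: "(\<And>i. i \<in> J \<Longrightarrow> i \<le> d \<Longrightarrow> i \<in> J') \<Longrightarrow> eigen_sum J \<subseteq> eigen_sum J'"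
  by (auto simp: eigen_sum_def)

lemma eigen_sum_Int: "eigen_sum J \<inter> eigen_sum J' = eigen_sum (J \<inter> J')"
  by (auto simp: eigen_sum_def)

lemma eigen_sum_UNIV: "(\<And>i. i \<le> d \<Longrightarrow> i \<in> J) \<Longrightarrow> eigen_sum J = UNIV"
  by (auto simp: eigen_sum_def)

lemma eigen_sum_trivial: "(\<And>i. i \<in> J \<Longrightarrow> d < i) \<Longrightarrow> eigen_sum J = {0}"
proof -
  assume J: "\<And>i. i \<in> J \<Longrightarrow> d < i"
  have "v = 0" if "v \<in> eigen_sum J" for v
  proof -
    have "\<And>i. i \<le> d \<Longrightarrow> E i v = 0" using that J by (force simp: eigen_sum_def)
    then have "(\<Sum>i\<le>d. E i v) = 0" by (intro sum.neutral) simp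
    then show ?thesis by (simp add: sum_E)
  qed
  then show ?thesis using subspace_0 [OF subspace_eigen_sum] by blast
qed

lemma E_mem_eigen_sum: "i \<le> d \<Longrightarrow> i \<in> J \<Longrightarrow> E i v \<in> eigen_sum J"
  by (auto simp: eigen_sum_def E_E)

lemma subspace_sum_range_E:
  assumes "J \<subseteq> {..d}"
  shows "subspace_sum J (\<lambda>j. range (E j)) = eigen_sum J"
proof (intro equalityI subsetI)
  fix v assume "v \<in> subspace_sum J (\<lambda>j. range (E j))"
  then obtain w where w: "\<forall>j\<in>J. w j \<in> range (E j)" "v = (\<Sum>j\<in>J. w j)"
    by (auto simp: subspace_sum_def)
  have "w j \<in> eigen_sum J" if j: "j \<in> J" for j
  proof -
    obtain v where "w j = E j v" using w(1) j by blast
    then show ?thesis using E_mem_eigen_sum [of j J v] j assms by auto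
  qed
  then show "v \<in> eigen_sum J" unfolding w(2) by (intro subspace_sum subspace_eigen_sum)
next
  fix v assume v: "v \<in> eigen_sum J"
  have "v = (\<Sum>j\<le>d. E j v)" by (simp add: sum_E)
  also have "\<dots> = (\<Sum>j\<in>J. E j v)"
    by (rule sum.mono_neutral_right) (use v assms in \<open>auto simp: eigen_sum_def\<close>)
  finally show "v \<in> subspace_sum J (\<lambda>j. range (E j))"
    unfolding subspace_sum_def by blast
qed

lemma A_eigen_sum: "v \<in> eigen_sum J \<Longrightarrow> A v \<in> eigen_sum J"
  by (simp add: eigen_sum_def E_A)

lemma A_minus_eigenvalue: "v \<in> eigen_sum J \<Longrightarrow> A v - s (\<theta> h) v \<in> eigen_sum (J - {h})"
  by (auto simp: eigen_sum_def E_A E_simps)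

text \<open>
  On \<open>E i V\<close> with \<open>i \<notin> J\<close> the map \<open>A - \<theta> h\<close> is a nonzero scalar, so it cannot remove
  a component outside \<open>J\<close>.
\<close>

lemma eigen_sum_reflect:
  assumes "A v - s (\<theta> h) v \<in> eigen_sum J" "h \<in> J" "h \<le> d"
  shows "v \<in> eigen_sum J"
proof -
  have "E i v = 0" if i: "i \<le> d" "i \<notin> J" for i
  proof -
    have "E i (A v - s (\<theta> h) v) = 0" using assms(1) i by (simp add: eigen_sum_def)
    then have "s (\<theta> i - \<theta> h) (E i v) = 0"
      using i by (simp add: E_A E_simps scale_left_diff_distrib)
    moreover have "\<theta> i \<noteq> \<theta> h"
      using inj_onD [OF inj_eigenvalues, of i h] i assms(2,3) by auto
    ultimately show ?thesis by simp
  qed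
  then show ?thesis by (simp add: eigen_sum_def)
qed

end

text \<open>
  Diagonalizability makes the eigenspaces span \<open>V\<close>, and then \<open>E i v\<close> is the component of
  \<open>v\<close> in the \<open>i\<close>-th eigenspace.
\<close>

lemma standard_idempotents_diagonal_map:
  assumes "vector_space s" "Vector_Spaces.linear s s A" "diagonalizable s A"
    and ord: "standard_ordering s d A B W"
    and idem: "\<forall>i\<le>d. primitive_idempotent s A (W i) (E i)"
    and ran: "\<forall>i\<le>d. range (E i) = eigenspace s A (\<theta> i)"
  shows "diagonal_map s d A E \<theta>"
    and "i \<le> d \<Longrightarrow> j \<le> d \<Longrightarrow> Suc j < i \<or> Suc i < j \<Longrightarrow> E i (B (E j v)) = 0"
proof -
  interpret vector_space s by fact
  have bij: "bij_betw W {0..d} (eigenspaces s A)"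
    and tri: "\<And>i. i \<le> d \<Longrightarrow> B ` W i \<subseteq> subspace_sum {i - 1..min d (i + 1)} W"
    using ord by (auto simp: standard_ordering_def)
  have W: "W i \<in> eigenspaces s A" if "i \<le> d" for i
    using bij_betwE [OF bij] that by simp
  have W_inj: "i = j" if "i \<le> d" "j \<le> d" "W i = W j" for i j
    using inj_onD [OF bij_betw_imp_inj_on [OF bij]] that by simp
  have lin: "Vector_Spaces.linear s s (E i)" if "i \<le> d" for i
    using idem that by (simp add: primitive_idempotent_def)
  have E_W: "E i w = (if i = j then w else 0)" if "i \<le> d" "j \<le> d" "w \<in> W j" for i j w
  proof (cases "i = j")
    case False
    then have "W j \<in> eigenspaces s A - {W i}" using W W_inj that by auto
    then have "w \<in> span (\<Union>(eigenspaces s A - {W i}))" using that(3) by (intro span_base) blast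
    then show ?thesis using idem that False by (simp add: primitive_idempotent_def)
  qed (use idem that in \<open>simp add: primitive_idempotent_def\<close>)
  have sub: "subspace (W i)" if i: "i \<le> d" for i
  proof -
    obtain t where "W i = eigenspace s A t" using W [OF i] by (auto simp: eigenspaces_def)
    then show ?thesis
      by (simp add: eigenspace_def subspace_def linear_map_add [OF assms(2)] linear_map_scale [OF assms(2)]
          linear_map_0 [OF assms(2)] scale_right_distrib scale_left_commute)
  qed
  have span: "span (\<Union>i\<in>{..d}. W i) = UNIV"
  proof -
    obtain C where C: "\<not> dependent C" "span C = UNIV" "\<forall>b\<in>C. \<exists>t. A b = s t b"
      using assms(3) by (auto simp: diagonalizable_def)
    have "C \<subseteq> (\<Union>i\<in>{..d}. W i)"
    proof
      fix b assume b: "b \<in> C"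
      then obtain t where t: "A b = s t b" using C by blast
      have "b \<noteq> 0" using C(1) b dependent_zero by blast
      moreover have "b \<in> eigenspace s A t" using t by (simp add: eigenspace_def)
      ultimately have "eigenspace s A t \<in> eigenspaces s A" by (auto simp: eigenspaces_def)
      then have "eigenspace s A t \<in> W ` {0..d}" using bij_betw_imp_surj_on [OF bij] by simp
      then obtain i where "i \<le> d" "W i = eigenspace s A t" by auto
      with \<open>b \<in> eigenspace s A t\<close> show "b \<in> (\<Union>i\<in>{..d}. W i)" by auto
    qed
    then show ?thesis using span_mono C(2) by blast
  qed
  have decomp: "\<exists>w. (\<forall>i\<le>d. w i \<in> W i \<and> E i v = w i) \<and> v = (\<Sum>i\<le>d. w i)" for v
  proof -
    have "v \<in> span (\<Union>i\<in>{..d}. W i)" by (simp add: span)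
    then obtain w where w: "\<And>i. i \<in> {..d} \<Longrightarrow> w i \<in> W i" "v = (\<Sum>i\<le>d. w i)"
      by (rule span_UN_subspaces [rotated 2]) (use sub in auto)
    have "E i v = w i" if i: "i \<le> d" for i
    proof -
      have "E i v = (\<Sum>j\<le>d. E i (w j))" unfolding w(2) by (rule linear_map_sum [OF lin [OF i]])
      also have "\<dots> = (\<Sum>j\<le>d. if i = j then w j else 0)"
        using E_W [OF i] w(1) by (intro sum.cong) auto
      finally show ?thesis using i by simp
    qed
    with w show ?thesis by (intro exI [of _ w]) auto
  qed
  have E_in_W: "E i v \<in> W i" if "i \<le> d" for i v
    using decomp [of v] that by auto
  have ran_W: "range (E i) = W i" if "i \<le> d" for i
  proof (intro equalityI subsetI)
    fix x assume "x \<in> W i"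
    then have "E i x = x" using E_W [OF that that] by simp
    then show "x \<in> range (E i)" by (metis rangeI)
  qed (use E_in_W that in auto)
  show "diagonal_map s d A E \<theta>"
  proof (intro diagonal_map.intro diagonal_map_axioms.intro vector_space_axioms)
    show "inj_on \<theta> {..d}"
      by (rule inj_onI) (metis W_inj ran ran_W atMost_iff)
    show "(\<Sum>i\<le>d. E i v) = v" for v
      using decomp [of v] by auto
    fix i assume i: "i \<le> d"
    show "A (E i v) = s (\<theta> i) (E i v)" for v
    proof -
      have "E i v \<in> eigenspace s A (\<theta> i)" using ran i by blast
      then show ?thesis by (simp add: eigenspace_def)
    qed
    show "E i (E j v) = (if i = j then E i v else 0)" if "j \<le> d" for j v
      using E_W [OF i that E_in_W [OF that]] by auto
    have "W i \<noteq> {0}" using W [OF i] by (simp add: eigenspaces_def)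
    moreover have "0 \<in> W i" using sub [OF i] by (rule subspace_0)
    ultimately obtain w where "w \<in> W i" "w \<noteq> 0" by blast
    then show "\<exists>v. E i v \<noteq> 0" using E_W [OF i i] by metis
  qed (use assms(2) lin in auto)
  show "E i (B (E j v)) = 0" if ij: "i \<le> d" "j \<le> d" "Suc j < i \<or> Suc i < j"
  proof -
    have "B (E j v) \<in> subspace_sum {j - 1..min d (j + 1)} W"
      using tri [OF ij(2)] E_in_W [OF ij(2)] by blast
    then obtain w where w: "\<forall>l\<in>{j - 1..min d (j + 1)}. w l \<in> W l"
      "B (E j v) = (\<Sum>l\<in>{j - 1..min d (j + 1)}. w l)"
      by (auto simp: subspace_sum_def)
    have "E i (w l) = 0" if l: "l \<in> {j - 1..min d (j + 1)}" for l
    proof -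
      have "l \<le> d" "i \<noteq> l" using l ij by auto
      then show ?thesis using E_W [OF ij(1) \<open>l \<le> d\<close>] w(1) l by simp
    qed
    then show ?thesis unfolding w(2) linear_map_sum [OF lin [OF ij(1)]] by (intro sum.neutral) blast
  qed
qed

section \<open>Tridiagonal systems\<close>

locale td_operators =
  finite_dimensional_vector_space s Basis +
  plain: diagonal_map s d A E \<theta> + dual: diagonal_map s d As Es \<theta>s
  for s :: "'k::field \<Rightarrow> 'v::ab_group_add \<Rightarrow> 'v" and Basis :: "'v set"
    and d :: nat and A As :: "'v \<Rightarrow> 'v" and E Es :: "nat \<Rightarrow> 'v \<Rightarrow> 'v" and \<theta> \<theta>s :: "nat \<Rightarrow> 'k" +
  assumes E_As_E: "i \<le> d \<Longrightarrow> j \<le> d \<Longrightarrow> Suc j < i \<or> Suc i < j \<Longrightarrow> E i (As (E j v)) = 0"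
    and Es_A_Es: "i \<le> d \<Longrightarrow> j \<le> d \<Longrightarrow> Suc j < i \<or> Suc i < j \<Longrightarrow> Es i (A (Es j v)) = 0"
    and irreducible: "subspace W \<Longrightarrow> A ` W \<subseteq> W \<Longrightarrow> As ` W \<subseteq> W \<Longrightarrow> W \<noteq> {0} \<Longrightarrow> W = UNIV"

lemma td_system_td_operators:
  assumes "finite_dimensional_vector_space s Basis" "td_system s d A E As Es"
    and "\<forall>i\<le>d. range (E i) = eigenspace s A (\<theta> i)"
    and "\<forall>i\<le>d. range (Es i) = eigenspace s As (\<theta>s i)"
  shows "td_operators s Basis d A As E Es \<theta> \<theta>s"
proof -
  interpret finite_dimensional_vector_space s Basis by fact
  have td: "Vector_Spaces.linear s s A" "Vector_Spaces.linear s s As"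
     "diagonalizable s A" "diagonalizable s As"
    and irr: "\<not> (\<exists>W. subspace W \<and> A ` W \<subseteq> W \<and> As ` W \<subseteq> W \<and> W \<noteq> {0} \<and> W \<noteq> UNIV)"
    and idem: "standard_idempotents s d A As E" "standard_idempotents s d As A Es"
    using assms(2) by (simp_all add: td_system_def td_pair_def)
  obtain W where W: "standard_ordering s d A As W" "\<forall>i\<le>d. primitive_idempotent s A (W i) (E i)"
    using idem(1) by (auto simp: standard_idempotents_def)
  obtain Ws where Ws: "standard_ordering s d As A Ws" "\<forall>i\<le>d. primitive_idempotent s As (Ws i) (Es i)"
    using idem(2) by (auto simp: standard_idempotents_def)
  note plain = standard_idempotents_diagonal_map [OF vector_space_axioms td(1,3) W assms(3)]
  note dual = standard_idempotents_diagonal_map [OF vector_space_axioms td(2,4) Ws assms(4)]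
  show ?thesis
  proof (intro td_operators.intro td_operators_axioms.intro plain dual assms(1))
    show "W = UNIV" if "subspace W" "A ` W \<subseteq> W" "As ` W \<subseteq> W" "W \<noteq> {0}" for W
      using irr that by blast
  qed
qed

context td_operators
begin

lemma dual_map_eigen_sum:
  assumes "v \<in> plain.eigen_sum J"
    and "\<And>i j. j \<in> J \<Longrightarrow> i \<le> Suc j \<Longrightarrow> j \<le> Suc i \<Longrightarrow> i \<in> J'"
  shows "As v \<in> plain.eigen_sum J'"
  unfolding plain.eigen_sum_def
proof (intro CollectI allI impI)
  fix i assume i: "i \<le> d" "i \<notin> J'"
  have "E i (As (E j v)) = 0" if "j \<le> d" for j
  proof (cases "j \<in> J")
    case True
    then have "\<not> (i \<le> Suc j \<and> j \<le> Suc i)" using assms(2) i by blast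
    then show ?thesis using E_As_E [OF i(1) that] by auto
  next
    case False
    then have "E j v = 0" using assms(1) that by (simp add: plain.eigen_sum_def)
    then show ?thesis using i by (simp add: dual.A_simps plain.E_simps)
  qed
  then have "(\<Sum>j\<le>d. E i (As (E j v))) = 0" by (intro sum.neutral) auto
  also have "(\<Sum>j\<le>d. E i (As (E j v))) = E i (As (\<Sum>j\<le>d. E j v))"
    by (simp add: dual.A_simps plain.E_simps [OF i(1)])
  finally show "E i (As v) = 0" by (simp add: plain.sum_E)
qed

text \<open>
  Exchanging the two maps gives a tridiagonal system again, so every statement has a
  dual.
\<close>

lemma swap: "td_operators s Basis d As A Es E \<theta>s \<theta>"
  by unfold_locales (use E_As_E Es_A_Es irreducible in auto)

lemma map_dual_eigen_sum:
  assumes "v \<in> dual.eigen_sum J"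
    and "\<And>i j. j \<in> J \<Longrightarrow> i \<le> Suc j \<Longrightarrow> j \<le> Suc i \<Longrightarrow> i \<in> J'"
  shows "A v \<in> dual.eigen_sum J'"
proof -
  interpret swapped: td_operators s Basis d As A Es E \<theta>s \<theta> by (rule swap)
  show ?thesis using assms by (rule swapped.dual_map_eigen_sum)
qed

end

section \<open>The split decomposition\<close>

lemma (in vector_space) linear_image_span_subset:
  assumes "Vector_Spaces.linear scale scale h" "\<And>v. v \<in> T \<Longrightarrow> h v \<in> span T"
  shows "h ` span T \<subseteq> span T"
proof -
  have "subspace {v. h v \<in> span T}"
    by (rule subspaceI) (auto simp: linear_map_simps [OF assms(1)] span_zero span_add span_scale)
  then have "span T \<subseteq> {v. h v \<in> span T}" using assms(2) by (intro span_minimal) auto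
  then show ?thesis by blast
qed

context td_operators
begin

text \<open>
  Subtracting a scalar multiple of the identity does not change which subspaces are
  invariant, so the span is invariant under both maps and irreducibility applies.
\<close>

lemma span_UN_invariant:
  assumes "\<And>i v. v \<in> X i \<Longrightarrow> \<exists>c j. A v - s c v \<in> X j"
    and "\<And>i v. v \<in> X i \<Longrightarrow> \<exists>c j. As v - s c v \<in> X j"
  shows "span (\<Union>i::nat. X i) \<subseteq> {0} \<or> span (\<Union>i. X i) = UNIV"
proof -
  let ?T = "\<Union>i. X i"
  have "h v \<in> span ?T"
    if hX: "\<And>i v. v \<in> X i \<Longrightarrow> \<exists>c j. h v - s c v \<in> X j" and v: "v \<in> ?T" for h :: "'v \<Rightarrow> 'v" and v
  proof -
    obtain c j where "h v - s c v \<in> X j" using hX v by blast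
    then have "h v - s c v \<in> span ?T" by (intro span_base) blast
    moreover have "s c v \<in> span ?T" using v by (intro span_scale span_base)
    ultimately have "(h v - s c v) + s c v \<in> span ?T" by (rule span_add)
    then show ?thesis by simp
  qed
  note * = this
  have "A ` span ?T \<subseteq> span ?T"
    by (rule linear_image_span_subset [OF plain.linear_A], rule *) (use assms in blast)+
  moreover have "As ` span ?T \<subseteq> span ?T"
    by (rule linear_image_span_subset [OF dual.linear_A], rule *) (use assms in blast)+
  ultimately show ?thesis using irreducible [of "span ?T"] by auto
qed

text \<open>
  The tridiagonal relation lets \<open>A\<close> enlarge the first factor by one dual eigenspace,
  while \<open>A - \<theta> i\<close> kills the component in \<open>E i V\<close>.
\<close>

lemma raise_mem:
  assumes "v \<in> dual.eigen_sum {..<j} \<inter> plain.eigen_sum {i..}"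
  shows "A v - s (\<theta> i) v \<in> dual.eigen_sum {..<Suc j} \<inter> plain.eigen_sum {Suc i..}"
proof
  have "A v \<in> dual.eigen_sum {..<Suc j}"
    by (rule map_dual_eigen_sum [of v "{..<j}"]) (use assms in auto)
  moreover have "v \<in> dual.eigen_sum {..<Suc j}"
    using assms dual.eigen_sum_mono [of "{..<j}" "{..<Suc j}"] by auto
  ultimately show "A v - s (\<theta> i) v \<in> dual.eigen_sum {..<Suc j}"
    by (intro subspace_diff subspace_scale dual.subspace_eigen_sum)
  have "{i..} - {i} = {Suc i..}" by auto
  then show "A v - s (\<theta> i) v \<in> plain.eigen_sum {Suc i..}"
    using assms plain.A_minus_eigenvalue [of v "{i..}" i] by auto
qed

lemma lower_mem:
  assumes "v \<in> dual.eigen_sum {..<Suc j} \<inter> plain.eigen_sum {i..}"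
  shows "As v - s (\<theta>s j) v \<in> dual.eigen_sum {..<j} \<inter> plain.eigen_sum {i - 1..}"
proof
  have "As v \<in> plain.eigen_sum {i - 1..}"
    by (rule dual_map_eigen_sum [of v "{i..}"]) (use assms in auto)
  moreover have "v \<in> plain.eigen_sum {i - 1..}"
  proof -
    have "plain.eigen_sum {i..} \<subseteq> plain.eigen_sum {i - 1..}" by (rule plain.eigen_sum_mono) auto
    then show ?thesis using assms by blast
  qed
  ultimately show "As v - s (\<theta>s j) v \<in> plain.eigen_sum {i - 1..}"
    by (intro subspace_diff subspace_scale plain.subspace_eigen_sum)
  have "{..<Suc j} - {j} = {..<j}" by auto
  then show "As v - s (\<theta>s j) v \<in> dual.eigen_sum {..<j}"
    using assms dual.A_minus_eigenvalue [of v "{..<Suc j}" j] by auto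
qed

text \<open>
  The span of these intersections is invariant, and it is not all of \<open>V\<close> because it
  lies in \<open>E\<^sub>1 V + \<dots> + E\<^sub>d V\<close>.
\<close>

lemma eigen_sums_disjoint: "dual.eigen_sum {..<i} \<inter> plain.eigen_sum {i..} = {0}"
proof -
  define X where "X i = dual.eigen_sum {..<i} \<inter> plain.eigen_sum {i..}" for i
  have X0: "X 0 = {0}"
    using dual.eigen_sum_trivial [of "{..<0}"] subspace_0 [OF plain.subspace_eigen_sum]
    by (auto simp: X_def)
  have "span (\<Union>i. X i) \<subseteq> {0} \<or> span (\<Union>i. X i) = UNIV"
  proof (rule span_UN_invariant)
    fix i v assume v: "v \<in> X i"
    then have "A v - s (\<theta> i) v \<in> X (Suc i)" unfolding X_def by (rule raise_mem)
    then show "\<exists>c j. A v - s c v \<in> X j" by blast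
    show "\<exists>c j. As v - s c v \<in> X j"
    proof (cases i)
      case 0
      then have "v = 0" using v X0 by simp
      then have "As v - s 0 v \<in> X 0" using X0 by (simp add: dual.A_simps)
      then show ?thesis by blast
    next
      case (Suc j)
      then have "As v - s (\<theta>s j) v \<in> X j"
        using lower_mem [of v j i] v by (simp add: X_def)
      then show ?thesis by blast
    qed
  qed
  moreover have "span (\<Union>i. X i) \<subseteq> plain.eigen_sum {1..}"
  proof (rule span_minimal [OF _ plain.subspace_eigen_sum], rule UN_least)
    fix i show "X i \<subseteq> plain.eigen_sum {1..}"
    proof (cases i)
      case 0
      then show ?thesis using X0 subspace_0 [OF plain.subspace_eigen_sum] by simp
    next
      case (Suc j)
      then have "plain.eigen_sum {i..} \<subseteq> plain.eigen_sum {1..}" by (intro plain.eigen_sum_mono) auto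
      then show ?thesis by (auto simp: X_def)
    qed
  qed
  moreover have "plain.eigen_sum {1..} \<noteq> UNIV"
  proof
    assume "plain.eigen_sum {1..} = UNIV"
    then have "E 0 v = 0" for v by (auto simp: plain.eigen_sum_def)
    then show False using plain.E_nonzero [of 0] by simp
  qed
  ultimately have "span (\<Union>i. X i) \<subseteq> {0}" by auto
  then have "X i \<subseteq> {0}" using span_superset by blast
  moreover have "0 \<in> X i"
    by (simp add: X_def subspace_0 plain.subspace_eigen_sum dual.subspace_eigen_sum)
  ultimately have "X i = {0}" by blast
  then show ?thesis by (simp add: X_def)
qed

definition U :: "nat \<Rightarrow> 'v set" where
  "U i = dual.eigen_sum {..<Suc i} \<inter> plain.eigen_sum {i..}"

lemma subspace_U: "subspace (U i)"
  unfolding U_def by (intro subspace_inter plain.subspace_eigen_sum dual.subspace_eigen_sum)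

lemma U_beyond: "d < i \<Longrightarrow> U i = {0}"
  using plain.eigen_sum_trivial [of "{i..}"] subspace_0 [OF dual.subspace_eigen_sum]
  by (auto simp: U_def)

lemma raise_U: "u \<in> U i \<Longrightarrow> A u - s (\<theta> i) u \<in> U (Suc i)"
  unfolding U_def by (rule raise_mem)

text \<open>
  Here invariance forces the span to be \<open>V\<close>, because \<open>U 0 = E\<^sup>*\<^sub>0 V\<close> is nonzero.
\<close>

lemma span_U: "span (\<Union>i\<in>{..d}. U i) = UNIV"
proof -
  have "span (\<Union>i. U i) \<subseteq> {0} \<or> span (\<Union>i. U i) = UNIV"
  proof (rule span_UN_invariant)
    fix i v assume v: "v \<in> U i"
    show "\<exists>c j. A v - s c v \<in> U j" using raise_U [OF v] by blast
    show "\<exists>c j. As v - s c v \<in> U j"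
    proof (cases i)
      case 0
      have "As v - s (\<theta>s 0) v \<in> dual.eigen_sum {..<0}"
        using lower_mem [of v 0 i] v 0 by (simp add: U_def)
      also have "dual.eigen_sum {..<0} = {0}" by (rule dual.eigen_sum_trivial) simp
      finally have "As v - s (\<theta>s 0) v \<in> U 0" using subspace_0 [OF subspace_U] by auto
      then show ?thesis by blast
    next
      case (Suc j)
      then have "As v - s (\<theta>s i) v \<in> U j"
        using lower_mem [of v i i] v by (simp add: U_def)
      then show ?thesis by blast
    qed
  qed
  moreover have "\<not> span (\<Union>i. U i) \<subseteq> {0}"
  proof -
    obtain v where v: "Es 0 v \<noteq> 0" using dual.E_nonzero [of 0] by blast
    have "plain.eigen_sum {0..} = UNIV" by (rule plain.eigen_sum_UNIV) simp
    then have "Es 0 v \<in> U 0" by (simp add: U_def dual.E_mem_eigen_sum)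
    then have "Es 0 v \<in> span (\<Union>i. U i)" by (intro span_base) blast
    with v show ?thesis by blast
  qed
  ultimately have "span (\<Union>i. U i) = UNIV" by blast
  moreover have "(\<Union>i. U i) \<subseteq> span (\<Union>i\<in>{..d}. U i)"
  proof (rule UN_least)
    fix i show "U i \<subseteq> span (\<Union>i\<in>{..d}. U i)"
      by (cases "i \<le> d") (auto intro: span_base simp: U_beyond span_zero not_le)
  qed
  then have "span (\<Union>i. U i) \<subseteq> span (\<Union>i\<in>{..d}. U i)" by (intro span_minimal) auto
  ultimately show ?thesis by blast
qed

lemma split_decomposition: "\<exists>u. (\<forall>i\<le>d. u i \<in> U i) \<and> v = (\<Sum>i\<le>d. u i)"
proof -
  have "v \<in> span (\<Union>i\<in>{..d}. U i)" by (simp add: span_U)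
  then obtain u where "\<And>i. i \<in> {..d} \<Longrightarrow> u i \<in> U i" "v = (\<Sum>i\<le>d. u i)"
    by (rule span_UN_subspaces [rotated 2]) (use subspace_U in auto)
  then show ?thesis by auto
qed

lemma dim_image_of_U:
  assumes "Vector_Spaces.linear s s h" "\<And>u. u \<in> U i \<Longrightarrow> h u = 0 \<Longrightarrow> u = 0" "range h \<subseteq> h ` U i"
  shows "dim (range h) = dim (U i)"
proof -
  interpret pair: finite_dimensional_vector_space_pair s Basis s Basis by unfold_locales
  have "inj_on h (span (U i))"
  proof (rule inj_onI)
    fix x y assume "x \<in> span (U i)" "y \<in> span (U i)" and eq: "h x = h y"
    then have "x - y \<in> U i" using span_diff span_eq_iff subspace_U by blast
    moreover have "h (x - y) = 0" using eq by (simp add: linear_map_diff [OF assms(1)])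
    ultimately show "x = y" using assms(2) by fastforce
  qed
  then have "dim (h ` U i) = dim (U i)" by (rule pair.dim_image_eq [OF assms(1)])
  moreover have "h ` U i = range h" using assms(3) by blast
  ultimately show ?thesis by simp
qed

text \<open>
  The projection \<open>E\<^sup>* i\<close> restricts to a bijection from \<open>U i\<close> to \<open>E\<^sup>* i V\<close>.  Its kernel on
  \<open>U i\<close> is one of the zero intersections above.  It is onto because a vector of
  \<open>E\<^sup>* i V\<close> has split components only up to index \<open>i\<close>, and those below \<open>i\<close> are killed
  by \<open>E\<^sup>* i\<close>.
\<close>

lemma dim_U_dual:
  assumes i: "i \<le> d"
  shows "dim (range (Es i)) = dim (U i)"
proof (rule dim_image_of_U [OF dual.linear_E [OF i]])
  fix u assume u: "u \<in> U i" "Es i u = 0"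
  have "u \<in> dual.eigen_sum {..<i}"
    using u unfolding U_def dual.eigen_sum_def by (auto simp: less_Suc_eq)
  then have "u \<in> dual.eigen_sum {..<i} \<inter> plain.eigen_sum {i..}" using u(1) by (simp add: U_def)
  then show "u = 0" by (simp add: eigen_sums_disjoint)
next
  show "range (Es i) \<subseteq> Es i ` U i"
  proof
    fix w assume "w \<in> range (Es i)"
    then obtain v where v: "w = Es i v" by blast
    obtain u where u: "\<And>j. j \<le> d \<Longrightarrow> u j \<in> U j" "w = (\<Sum>j\<le>d. u j)"
      using split_decomposition [of w] by blast
    have split: "(\<Sum>j\<le>d. u j) = (\<Sum>j\<le>i. u j) + (\<Sum>j\<in>{i<..d}. u j)"
      using i by (subst sum.union_disjoint [symmetric]) (auto intro!: sum.cong)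
    have low: "u j \<in> dual.eigen_sum {..<Suc i}" if "j \<le> i" for j
      using u(1) [of j] that i dual.eigen_sum_mono [of "{..<Suc j}" "{..<Suc i}"] by (auto simp: U_def)
    have "u j \<in> plain.eigen_sum {Suc i..}" if "i < j" "j \<le> d" for j
      using u(1) [of j] that plain.eigen_sum_mono [of "{j..}" "{Suc i..}"] by (auto simp: U_def)
    then have "(\<Sum>j\<in>{i<..d}. u j) \<in> plain.eigen_sum {Suc i..}"
      by (intro subspace_sum plain.subspace_eigen_sum) auto
    moreover have "(\<Sum>j\<in>{i<..d}. u j) = w - (\<Sum>j\<le>i. u j)" using split u(2) by simp
    moreover have "w - (\<Sum>j\<le>i. u j) \<in> dual.eigen_sum {..<Suc i}"
      using low i unfolding v
      by (intro subspace_diff subspace_sum dual.subspace_eigen_sum dual.E_mem_eigen_sum) auto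
    ultimately have "(\<Sum>j\<in>{i<..d}. u j) \<in> dual.eigen_sum {..<Suc i} \<inter> plain.eigen_sum {Suc i..}"
      by simp
    then have "w = (\<Sum>j\<le>i. u j)" using split u(2) by (simp add: eigen_sums_disjoint)
    then have "Es i w = (\<Sum>j\<le>i. Es i (u j))" by (simp add: dual.E_simps [OF i])
    also have "\<dots> = (\<Sum>j\<le>i. if j = i then Es i (u i) else 0)"
      using u(1) i by (intro sum.cong) (auto simp: U_def dual.eigen_sum_def)
    also have "\<dots> = Es i (u i)" by simp
    finally have "w = Es i (u i)" using i by (simp add: v dual.E_E)
    then show "w \<in> Es i ` U i" using u(1) [OF i] by blast
  qed
qed

text \<open>
  The same argument from the other end: a vector of \<open>E i V\<close> has split components only
  from index \<open>i\<close> on.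
\<close>

lemma dim_U:
  assumes i: "i \<le> d"
  shows "dim (range (E i)) = dim (U i)"
proof (rule dim_image_of_U [OF plain.linear_E [OF i]])
  fix u assume u: "u \<in> U i" "E i u = 0"
  have "u \<in> plain.eigen_sum {Suc i..}"
    using u unfolding U_def plain.eigen_sum_def by (auto simp: not_le Suc_le_eq)
  then have "u \<in> dual.eigen_sum {..<Suc i} \<inter> plain.eigen_sum {Suc i..}" using u(1) by (simp add: U_def)
  then show "u = 0" by (simp add: eigen_sums_disjoint)
next
  show "range (E i) \<subseteq> E i ` U i"
  proof
    fix w assume "w \<in> range (E i)"
    then obtain v where v: "w = E i v" by blast
    obtain u where u: "\<And>j. j \<le> d \<Longrightarrow> u j \<in> U j" "w = (\<Sum>j\<le>d. u j)"
      using split_decomposition [of w] by blast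
    have split: "(\<Sum>j\<le>d. u j) = (\<Sum>j<i. u j) + (\<Sum>j\<in>{i..d}. u j)"
      using i by (subst sum.union_disjoint [symmetric]) (auto intro!: sum.cong)
    have high: "u j \<in> plain.eigen_sum {i..}" if "i \<le> j" "j \<le> d" for j
      using u(1) [of j] that plain.eigen_sum_mono [of "{j..}" "{i..}"] by (auto simp: U_def)
    have "u j \<in> dual.eigen_sum {..<i}" if "j < i" for j
      using u(1) [of j] that i dual.eigen_sum_mono [of "{..<Suc j}" "{..<i}"] by (auto simp: U_def)
    then have "(\<Sum>j<i. u j) \<in> dual.eigen_sum {..<i}"
      by (intro subspace_sum dual.subspace_eigen_sum) auto
    moreover have "(\<Sum>j<i. u j) = w - (\<Sum>j\<in>{i..d}. u j)" using split u(2) by simp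
    moreover have "w - (\<Sum>j\<in>{i..d}. u j) \<in> plain.eigen_sum {i..}"
      using high i unfolding v
      by (intro subspace_diff subspace_sum plain.subspace_eigen_sum plain.E_mem_eigen_sum) auto
    ultimately have "(\<Sum>j<i. u j) \<in> dual.eigen_sum {..<i} \<inter> plain.eigen_sum {i..}"
      by simp
    then have "w = (\<Sum>j\<in>{i..d}. u j)" using split u(2) by (simp add: eigen_sums_disjoint)
    then have "E i w = (\<Sum>j\<in>{i..d}. E i (u j))" by (simp add: plain.E_simps [OF i])
    also have "\<dots> = (\<Sum>j\<in>{i..d}. if j = i then E i (u i) else 0)"
      using u(1) i by (intro sum.cong) (auto simp: U_def plain.eigen_sum_def)
    also have "\<dots> = E i (u i)" using i by simp
    finally have "w = E i (u i)" using i by (simp add: v plain.E_E)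
    then show "w \<in> E i ` U i" using u(1) [OF i] by blast
  qed
qed

text \<open>
  The condition on the \<open>E i\<close> only compares neighbours, so it survives the reversal of
  the ordering.
\<close>

lemma reversed: "td_operators s Basis d A As (\<lambda>i. E (d - i)) Es (\<lambda>i. \<theta> (d - i)) \<theta>s"
proof -
  have sum: "(\<Sum>i\<le>d. E (d - i) v) = v" for v
    using sum.nat_diff_reindex [of "\<lambda>i. E i v" "Suc d"] plain.sum_E [of v]
    by (simp add: lessThan_Suc_atMost)
  have inj: "inj_on (\<lambda>i. \<theta> (d - i)) {..d}"
  proof (rule inj_onI)
    fix i j assume ij: "i \<in> {..d}" "j \<in> {..d}" "\<theta> (d - i) = \<theta> (d - j)"
    then have "d - i = d - j" using inj_onD [OF plain.inj_eigenvalues] by simp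
    then show "i = j" using ij by auto
  qed
  have "diagonal_map s d A (\<lambda>i. E (d - i)) (\<lambda>i. \<theta> (d - i))"
    by (intro diagonal_map.intro diagonal_map_axioms.intro vector_space_axioms)
       (use sum inj in \<open>auto simp: plain.linear_E plain.E_E plain.A_E plain.E_nonzero plain.linear_A\<close>)
  then show ?thesis
    by (intro td_operators.intro td_operators_axioms.intro finite_dimensional_vector_space_axioms
        dual.diagonal_map_axioms)
       (use irreducible Es_A_Es in \<open>auto intro!: E_As_E\<close>)
qed

lemma eigen_sums_disjoint_reversed:
  assumes "i + j \<le> d"
  shows "dual.eigen_sum {..<Suc i} \<inter> plain.eigen_sum {..<j} = {0}"
proof -
  interpret rev: td_operators s Basis d A As "\<lambda>i. E (d - i)" Es "\<lambda>i. \<theta> (d - i)" \<theta>s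
    by (rule reversed)
  have "plain.eigen_sum {..<j} \<subseteq> rev.plain.eigen_sum {Suc i..}"
    using assms by (auto simp: plain.eigen_sum_def rev.plain.eigen_sum_def)
  then have "dual.eigen_sum {..<Suc i} \<inter> plain.eigen_sum {..<j} \<subseteq> {0}"
    using rev.eigen_sums_disjoint [of "Suc i"] by blast
  then show ?thesis
    using subspace_0 [OF plain.subspace_eigen_sum] subspace_0 [OF dual.subspace_eigen_sum] by blast
qed

text \<open>
  Both split decompositions compute dimensions of eigenspaces.  The given ordering
  yields \<open>dim (E i V) = dim (E\<^sup>* i V)\<close> and the reversed one
  \<open>dim (E\<^sub>d\<^sub>-\<^sub>i V) = dim (E\<^sup>* i V)\<close>.
\<close>

lemma dim_U_symmetric:
  assumes i: "i \<le> d"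
  shows "dim (U (d - i)) = dim (U i)"
proof -
  interpret rev: td_operators s Basis d A As "\<lambda>i. E (d - i)" Es "\<lambda>i. \<theta> (d - i)" \<theta>s
    by (rule reversed)
  have "dim (U (d - i)) = dim (range (Es (d - i)))" by (simp add: dim_U_dual)
  also have "\<dots> = dim (range (E (d - (d - i))))"
    using rev.dim_U_dual [of "d - i"] rev.dim_U [of "d - i"] by simp
  also have "\<dots> = dim (U i)" using i by (simp add: dim_U)
  finally show ?thesis .
qed

end

locale td_raising = td_operators +
  fixes R :: "'b \<Rightarrow> 'b"
  assumes linear_R: "Vector_Spaces.linear s s R"
    and R_U: "i \<le> d \<Longrightarrow> u \<in> U i \<Longrightarrow> R u = A u - s (\<theta> i) u"
begin

lemmas R_simps = linear_map_simps [OF linear_R]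

lemma R_mem_U: "u \<in> U i \<Longrightarrow> R u \<in> U (Suc i)"
proof (cases "i \<le> d")
  case False
  moreover assume "u \<in> U i"
  ultimately show ?thesis using U_beyond [of i] subspace_0 [OF subspace_U] by (auto simp: R_simps)
qed (simp add: R_U raise_U)

lemma R_power_mem_U: "u \<in> U i \<Longrightarrow> (R ^^ m) u \<in> U (i + m)"
  by (induction m) (auto intro: R_mem_U)

lemma linear_R_power: "Vector_Spaces.linear s s (R ^^ m)"
proof (induction m)
  case 0
  show ?case using linear_id by (simp add: id_def)
next
  case (Suc m)
  show ?case using Vector_Spaces.linear_compose [OF Suc linear_R] by (simp add: comp_def)
qed

text \<open>
  The vector \<open>R ^ m u\<close> arises from \<open>u\<close> by applying \<open>A - \<theta> h\<close> for \<open>h = i, \<dots>, i + m - 1\<close>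
  in turn, and none of these factors can remove a component outside \<open>J\<close>.
\<close>

lemma R_power_reflect:
  assumes "u \<in> U i" "(R ^^ m) u \<in> plain.eigen_sum J" "{i..<i + m} \<subseteq> J" "i + m \<le> Suc d"
  shows "u \<in> plain.eigen_sum J"
  using assms(2-4)
proof (induction m)
  case (Suc m)
  have "(R ^^ m) u \<in> U (i + m)" using assms(1) by (rule R_power_mem_U)
  then have "A ((R ^^ m) u) - s (\<theta> (i + m)) ((R ^^ m) u) \<in> plain.eigen_sum J"
    using Suc.prems R_U [of "i + m" "(R ^^ m) u"] by simp
  then have "(R ^^ m) u \<in> plain.eigen_sum J"
    by (rule plain.eigen_sum_reflect) (use Suc.prems in auto)
  then show ?case using Suc by (auto simp: subset_iff)
qed simp

text \<open>
  A vector of the kernel has no components in \<open>E h V\<close> for \<open>h \<ge> d - i\<close>, so it lies in one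
  of the zero intersections for the reversed ordering.
\<close>

lemma R_power_injective:
  assumes "2 * i \<le> d" "u \<in> U i" "(R ^^ (d - 2 * i)) u = 0"
  shows "u = 0"
proof -
  have "u \<in> plain.eigen_sum {..<d - i}"
    by (rule R_power_reflect [OF assms(2), of "d - 2 * i"])
       (use assms subspace_0 [OF plain.subspace_eigen_sum] in auto)
  then have "u \<in> dual.eigen_sum {..<Suc i} \<inter> plain.eigen_sum {..<d - i}"
    using assms(2) by (simp add: U_def)
  then show ?thesis using eigen_sums_disjoint_reversed [of i "d - i"] assms(1) by simp
qed

lemma R_power_surjective:
  assumes "2 * i \<le> d"
  shows "(R ^^ (d - 2 * i)) ` U i = U (d - i)"
proof (rule subspace_dim_equal)
  interpret pair: finite_dimensional_vector_space_pair s Basis s Basis by unfold_locales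
  let ?h = "R ^^ (d - 2 * i)"
  have "inj_on ?h (span (U i))"
  proof (rule inj_onI)
    fix x y assume "x \<in> span (U i)" "y \<in> span (U i)" and eq: "?h x = ?h y"
    then have "x - y \<in> U i" using span_diff span_eq_iff subspace_U by blast
    moreover have "?h (x - y) = 0" using eq by (simp add: linear_map_diff [OF linear_R_power])
    ultimately show "x = y" using R_power_injective [OF assms, of "x - y"] by simp
  qed
  then have "dim (?h ` U i) = dim (U i)" by (rule pair.dim_image_eq [OF linear_R_power])
  then show "dim (U (d - i)) \<le> dim (?h ` U i)" using dim_U_symmetric [of i] assms by simp
  show "subspace (?h ` U i)"
    by (rule module_hom.subspace_image [OF _ subspace_U])
       (use linear_R_power in \<open>simp add: Vector_Spaces.linear_def\<close>)
  show "subspace (U (d - i))" by (rule subspace_U)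
  show "?h ` U i \<subseteq> U (d - i)"
  proof
    fix x assume "x \<in> ?h ` U i"
    then obtain u where "u \<in> U i" "x = ?h u" by blast
    moreover have "i + (d - 2 * i) = d - i" using assms by simp
    ultimately show "x \<in> U (d - i)" using R_power_mem_U [of u i "d - 2 * i"] by simp
  qed
qed

definition K_space :: "nat \<Rightarrow> 'b set" where
  "K_space i = dual.eigen_sum {..<Suc i} \<inter> plain.eigen_sum {i..d - i}"

lemma K_space_subset_U: "K_space i \<subseteq> U i"
  using plain.eigen_sum_mono [of "{i..d - i}" "{i..}"] by (auto simp: K_space_def U_def)

lemma R_power_K_space:
  assumes "2 * i \<le> d" "u \<in> K_space i"
  shows "(R ^^ Suc (d - 2 * i)) u = 0"
proof -
  have u: "u \<in> U i" using assms K_space_subset_U by blast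
  have "(R ^^ m) u \<in> plain.eigen_sum {i..d - i}" if "i + m \<le> Suc d" for m
    using that
  proof (induction m)
    case 0
    then show ?case using assms(2) by (simp add: K_space_def)
  next
    case (Suc m)
    then have "(R ^^ m) u \<in> plain.eigen_sum {i..d - i}" by simp
    moreover have "R ((R ^^ m) u) = A ((R ^^ m) u) - s (\<theta> (i + m)) ((R ^^ m) u)"
      using Suc.prems R_power_mem_U [OF u, of m] by (intro R_U) auto
    ultimately show ?case
      by (simp add: subspace_diff subspace_scale plain.subspace_eigen_sum plain.A_eigen_sum)
  qed
  then have "(R ^^ Suc (d - 2 * i)) u \<in> plain.eigen_sum {i..d - i}"
    using assms(1) by (simp del: funpow.simps)
  moreover have "(R ^^ Suc (d - 2 * i)) u \<in> U (Suc (d - i))"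
    using R_power_mem_U [OF u, of "Suc (d - 2 * i)"] assms(1) by simp
  then have "(R ^^ Suc (d - 2 * i)) u \<in> plain.eigen_sum {Suc (d - i)..}" by (simp only: U_def IntD2)
  ultimately have "(R ^^ Suc (d - 2 * i)) u \<in> plain.eigen_sum ({i..d - i} \<inter> {Suc (d - i)..})"
    unfolding plain.eigen_sum_Int [symmetric] by blast
  also have "{i..d - i} \<inter> {Suc (d - i)..} = {}" by auto
  also have "plain.eigen_sum {} = {0}" by (rule plain.eigen_sum_trivial) simp
  finally show ?thesis by blast
qed

text \<open>
  With \<open>R_power_K_space\<close> this identifies \<open>K_space i\<close> with the kernel of \<open>R ^ (d - 2i + 1)\<close>
  on \<open>U i\<close>.
\<close>

lemma R_kernel_subset_K_space:
  assumes "2 * i \<le> d" "u \<in> U i" "(R ^^ Suc (d - 2 * i)) u = 0"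
  shows "u \<in> K_space i"
proof -
  have "u \<in> plain.eigen_sum {i..d - i}"
    by (rule R_power_reflect [OF assms(2), of "Suc (d - 2 * i)"])
       (use assms subspace_0 [OF plain.subspace_eigen_sum] in auto)
  then show ?thesis using assms(2) by (simp add: K_space_def U_def)
qed

lemma U_0: "u \<in> U 0 \<Longrightarrow> u \<in> K_space 0"
  using R_power_mem_U [of u 0 "Suc d"] U_beyond [of "Suc d"]
  by (intro R_kernel_subset_K_space) auto

text \<open>
  Write \<open>i'\<close> for \<open>i + 1\<close>.  If \<open>2i' \<le> d\<close>, then \<open>R ^ (d - 2i' + 1)\<close> maps \<open>u\<close> into \<open>U (d - i)\<close>,
  which is the image of \<open>U i\<close> under \<open>R ^ (d - 2i)\<close>; subtracting \<open>R w\<close> for a preimage \<open>w\<close>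
  leaves a vector of \<open>K_space i'\<close>.  Otherwise, for \<open>i' \<le> d\<close>, \<open>U i'\<close> is the image of
  \<open>U (d - i')\<close> under a positive power of \<open>R\<close>.
\<close>

lemma U_Suc:
  assumes "u \<in> U (Suc i)"
  obtains w c where "w \<in> U i" "u = R w + c" "c = 0 \<or> 2 * Suc i \<le> d \<and> c \<in> K_space (Suc i)"
proof (cases "2 * Suc i \<le> d")
  case True
  let ?n = "d - 2 * Suc i"
  have n: "d - 2 * i = Suc (Suc ?n)" "Suc i + Suc ?n = d - i" using True by simp_all
  have "(R ^^ Suc ?n) u \<in> U (d - i)"
    using R_power_mem_U [OF assms, of "Suc ?n"] unfolding n(2) .
  also have "U (d - i) = (R ^^ (d - 2 * i)) ` U i"
    using True by (simp add: R_power_surjective)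
  finally obtain w where w: "w \<in> U i" "(R ^^ Suc ?n) u = (R ^^ Suc ?n) (R w)"
    unfolding n(1) by (auto simp: funpow_swap1)
  have "(R ^^ Suc ?n) (u - R w) = 0"
    using w(2) by (simp only: linear_map_diff [OF linear_R_power]) simp
  moreover have "u - R w \<in> U (Suc i)"
    using assms w(1) R_mem_U by (intro subspace_diff subspace_U)
  ultimately have "u - R w \<in> K_space (Suc i)"
    using True by (intro R_kernel_subset_K_space)
  then show ?thesis using True w(1) by (intro that [of w "u - R w"]) auto
next
  case False
  show ?thesis
  proof (cases "Suc i \<le> d")
    case True
    define j where "j = d - Suc i"
    have j: "2 * j \<le> d" "d - j = Suc i" "d - 2 * j = Suc (i - j)" "j + (i - j) = i"
      using True False by (auto simp: j_def)
    have "u \<in> (R ^^ (d - 2 * j)) ` U j" using assms unfolding R_power_surjective [OF j(1)] j(2) .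
    then obtain w where w: "w \<in> U j" "u = R ((R ^^ (i - j)) w)" unfolding j(3) by auto
    have "(R ^^ (i - j)) w \<in> U i" using R_power_mem_U [OF w(1), of "i - j"] j(4) by simp
    then show ?thesis using w(2) by (intro that [of "(R ^^ (i - j)) w" 0]) auto
  next
    case False
    then have "u = 0" using assms U_beyond [of "Suc i"] by auto
    then show ?thesis using subspace_0 [OF subspace_U] by (intro that [of 0 0]) (auto simp: R_simps)
  qed
qed

lemma U_subset_if_contains_K_spaces:
  assumes "subspace P" "\<And>u. u \<in> P \<Longrightarrow> R u \<in> P" "\<And>i. 2 * i \<le> d \<Longrightarrow> K_space i \<subseteq> P"
  shows "U i \<subseteq> P"
proof (induction i)
  case 0
  then show ?case using U_0 assms(3) [of 0] by auto
next
  case (Suc i)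
  show ?case
  proof
    fix u assume "u \<in> U (Suc i)"
    then obtain w c where wc: "w \<in> U i" "u = R w + c"
      "c = 0 \<or> 2 * Suc i \<le> d \<and> c \<in> K_space (Suc i)" by (rule U_Suc)
    then have "c \<in> P" using assms(3) [of "Suc i"] subspace_0 [OF assms(1)] by auto
    moreover have "R w \<in> P" using wc(1) Suc assms(2) by blast
    ultimately show "u \<in> P" unfolding wc(2) by (intro subspace_add assms(1))
  qed
qed

end

section \<open>The module structure on a tridiagonal system\<close>

text \<open>
  The usual elimination: applying \<open>K - \<mu> j\<close> removes the \<open>j\<close>-th component and multiplies
  the others by nonzero scalars.
\<close>

lemma (in vector_space) eigenvector_components_mem:
  assumes "Vector_Spaces.linear scale scale K" "subspace W" "\<And>w. w \<in> W \<Longrightarrow> K w \<in> W"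
    and "finite I" "inj_on \<mu> I" "\<And>i. i \<in> I \<Longrightarrow> K (u i) = scale (\<mu> i) (u i)"
    and "(\<Sum>i\<in>I. u i) \<in> W"
  shows "\<forall>i\<in>I. u i \<in> W"
  using assms(4-7)
proof (induction I arbitrary: u rule: finite_induct)
  case (insert j I)
  let ?w = "\<Sum>i\<in>insert j I. u i"
  have w: "?w = u j + (\<Sum>i\<in>I. u i)" using insert.hyps by simp
  have "K ?w - scale (\<mu> j) ?w = (\<Sum>i\<in>I. scale (\<mu> i - \<mu> j) (u i))"
    unfolding w using insert.prems(2)
    by (simp add: linear_map_simps [OF assms(1)] scale_right_distrib scale_sum_right
        scale_left_diff_distrib sum_subtractf)
  moreover have "K ?w - scale (\<mu> j) ?w \<in> W"
    using insert.prems(3) assms(2,3) by (simp only: subspace_diff subspace_scale)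
  ultimately have "(\<Sum>i\<in>I. scale (\<mu> i - \<mu> j) (u i)) \<in> W" by simp
  then have *: "\<forall>i\<in>I. scale (\<mu> i - \<mu> j) (u i) \<in> W"
    using insert.prems
    by (intro insert.IH) (auto simp: linear_map_simps [OF assms(1)] scale_left_commute)
  have I: "u i \<in> W" if i: "i \<in> I" for i
  proof -
    have "\<mu> i \<noteq> \<mu> j" using insert.hyps insert.prems(1) i by (auto simp: inj_on_def)
    moreover have "scale (inverse (\<mu> i - \<mu> j)) (scale (\<mu> i - \<mu> j) (u i)) \<in> W"
      by (rule subspace_scale [OF assms(2) bspec [OF * i]])
    ultimately show ?thesis by simp
  qed
  have "?w - (\<Sum>i\<in>I. u i) \<in> W"
    by (intro subspace_diff [OF assms(2)] insert.prems subspace_sum [OF assms(2)] I)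
  with I show ?case by (simp add: w)
qed simp

lemma power_int_mult_self: "x \<noteq> 0 \<Longrightarrow> x powi z * x powi (- z) = (1 :: 'k::field)"
  by (simp add: power_int_minus)

lemma qnum_eq_0_imp:
  assumes "q \<noteq> 0" "q\<^sup>2 \<noteq> 1" "qnum q z = 0"
  shows "q powi (2 * z) = 1"
proof -
  have "q - inverse q \<noteq> 0" using assms(1,2) by (simp add: field_simps power2_eq_square)
  then have "q powi z = q powi (- z)" using assms(3) by (simp add: qnum_def)
  then have "q powi z * q powi z = q powi z * q powi (- z)" by simp
  also have "\<dots> = 1" using assms(1) by (rule power_int_mult_self)
  also have "q powi z * q powi z = q powi (2 * z)"
    unfolding mult_2 by (rule power_int_add [symmetric]) (use assms(1) in simp)
  finally show ?thesis .
qed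

text \<open>
  The maps \<open>K\<close>, \<open>R\<close> and \<open>\<psi>\<close> of the theorem, with \<open>Kinv\<close> for the inverse of \<open>K\<close> and with the condition on
  \<open>q\<close> that the distinctness of the eigenvalues provides.
\<close>

locale split_module = td_raising s Basis d A As E Es \<theta> \<theta>s R
  for s :: "'k::field \<Rightarrow> 'v::ab_group_add \<Rightarrow> 'v" and Basis :: "'v set"
    and d :: nat and A As :: "'v \<Rightarrow> 'v" and E Es :: "nat \<Rightarrow> 'v \<Rightarrow> 'v" and \<theta> \<theta>s :: "nat \<Rightarrow> 'k"
    and R :: "'v \<Rightarrow> 'v" +
  fixes q :: 'k and K Kinv \<psi> :: "'v \<Rightarrow> 'v"
  assumes q_not_0: "q \<noteq> 0" and q_squared_not_1: "q\<^sup>2 \<noteq> 1"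
    and q_power_not_1: "1 \<le> n \<Longrightarrow> n \<le> d \<Longrightarrow> q powi (2 * int n) \<noteq> 1"
    and linear_K: "Vector_Spaces.linear s s K" and linear_Kinv: "Vector_Spaces.linear s s Kinv"
    and K_U: "i \<le> d \<Longrightarrow> u \<in> U i \<Longrightarrow> K u = s (q powi (int d - 2 * int i)) u"
    and K_Kinv: "K (Kinv v) = v" and Kinv_K: "Kinv (K v) = v"
    and linear_psi: "Vector_Spaces.linear s s \<psi>"
    and psi_R: "\<psi> (R v) - R (\<psi> v) = s (q - inverse q) (K v - Kinv v)"
    and psi_K_space: "2 * i \<le> d \<Longrightarrow> u \<in> K_space i \<Longrightarrow> \<psi> u = 0"
begin

lemmas K_simps = linear_map_simps [OF linear_K]
lemmas Kinv_simps = linear_map_simps [OF linear_Kinv]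
lemmas psi_simps = linear_map_simps [OF linear_psi]

abbreviation e :: "'v \<Rightarrow> 'v" where "e \<equiv> \<lambda>v. s (inverse (q - inverse q)) (\<psi> v)"
abbreviation f :: "'v \<Rightarrow> 'v" where "f \<equiv> \<lambda>v. s (inverse (q - inverse q)) (R v)"

lemma q_diff_not_0: "q - inverse q \<noteq> 0"
  using q_not_0 q_squared_not_1 by (simp add: field_simps power2_eq_square)

lemma Kinv_U:
  assumes "i \<le> d" "u \<in> U i"
  shows "Kinv u = s (inverse (q powi (int d - 2 * int i))) u"
proof -
  have "Kinv (K u) = s (q powi (int d - 2 * int i)) (Kinv u)"
    using K_U [OF assms] by (simp add: Kinv_simps)
  then have "u = s (q powi (int d - 2 * int i)) (Kinv u)" by (simp add: Kinv_K)
  then have "s (inverse (q powi (int d - 2 * int i))) u =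
      s (inverse (q powi (int d - 2 * int i)) * q powi (int d - 2 * int i)) (Kinv u)"
    by (metis scale_scale)
  then show ?thesis using q_not_0 by simp
qed

lemma K_minus_Kinv_mem_U: "i \<le> d \<Longrightarrow> u \<in> U i \<Longrightarrow> s c (K u - Kinv u) \<in> U i"
  by (simp add: K_U Kinv_U subspace_diff subspace_scale subspace_U)

lemma psi_U_0: "u \<in> U 0 \<Longrightarrow> \<psi> u = 0"
  using U_0 psi_K_space [of 0] by simp

text \<open>
  Write \<open>u = R w + c\<close> as in \<open>U_Suc\<close>.  Then \<open>\<psi> c = 0\<close>, and the commutator turns \<open>\<psi> (R w)\<close>
  into \<open>R (\<psi> w)\<close> plus a multiple of \<open>w\<close>, to which the induction hypothesis applies.
\<close>

lemma psi_U_Suc: "Suc i \<le> d \<Longrightarrow> u \<in> U (Suc i) \<Longrightarrow> \<psi> u \<in> U i"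
proof (induction i arbitrary: u)
  case 0
  obtain w c where wc: "w \<in> U 0" "u = R w + c" "c = 0 \<or> 2 * Suc 0 \<le> d \<and> c \<in> K_space (Suc 0)"
    using 0(2) by (rule U_Suc)
  have "\<psi> c = 0" using wc(3) psi_K_space [of "Suc 0"] by (auto simp: psi_simps)
  then have "\<psi> u = s (q - inverse q) (K w - Kinv w)"
    using psi_R [of w] psi_U_0 [OF wc(1)] by (simp add: wc(2) psi_simps R_simps)
  then show ?case using K_minus_Kinv_mem_U [OF _ wc(1)] by simp
next
  case (Suc i)
  obtain w c where wc: "w \<in> U (Suc i)" "u = R w + c"
    "c = 0 \<or> 2 * Suc (Suc i) \<le> d \<and> c \<in> K_space (Suc (Suc i))"
    using Suc.prems(2) by (rule U_Suc)
  have "\<psi> c = 0" using wc(3) psi_K_space [of "Suc (Suc i)"] by (auto simp: psi_simps)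
  then have "\<psi> u = R (\<psi> w) + s (q - inverse q) (K w - Kinv w)"
    using psi_R [of w] by (simp add: wc(2) psi_simps algebra_simps)
  moreover have "R (\<psi> w) \<in> U (Suc i)"
    using Suc.IH [OF _ wc(1)] Suc.prems(1) by (intro R_mem_U) simp
  moreover have "s (q - inverse q) (K w - Kinv w) \<in> U (Suc i)"
    using Suc.prems(1) by (intro K_minus_Kinv_mem_U wc(1)) simp
  ultimately show ?case by (simp add: subspace_add subspace_U)
qed

lemma linear_eq_if_eq_on_U:
  assumes "Vector_Spaces.linear s s g" "Vector_Spaces.linear s s h"
    and "\<And>i u. i \<le> d \<Longrightarrow> u \<in> U i \<Longrightarrow> g u = h u"
  shows "g v = h v"
proof -
  obtain u where u: "\<And>i. i \<le> d \<Longrightarrow> u i \<in> U i" "v = (\<Sum>i\<le>d. u i)"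
    using split_decomposition [of v] by blast
  then show ?thesis
    using assms(3) by (simp add: linear_map_sum [OF assms(1)] linear_map_sum [OF assms(2)])
qed

lemma linear_scaled:
  assumes "Vector_Spaces.linear s s h"
  shows "Vector_Spaces.linear s s (\<lambda>v. s c (h v))"
  using Vector_Spaces.linear_compose [OF assms linear_scale_self [of c]] by (simp add: comp_def)

lemma linear_composed:
  assumes "Vector_Spaces.linear s s g" "Vector_Spaces.linear s s h"
  shows "Vector_Spaces.linear s s (\<lambda>v. g (h v))"
  using Vector_Spaces.linear_compose [OF assms(2,1)] by (simp add: comp_def)

lemma weight_step:
  "q powi (int d - 2 * int i) = q\<^sup>2 * q powi (int d - 2 * int (Suc i))"
  "q powi (int d - 2 * int (Suc i)) = (inverse q)\<^sup>2 * q powi (int d - 2 * int i)"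
proof -
  have "int d - 2 * int i = 2 + (int d - 2 * int (Suc i))" by simp
  then have "q powi (int d - 2 * int i) = q powi 2 * q powi (int d - 2 * int (Suc i))"
    using q_not_0 by (metis power_int_add)
  then show *: "q powi (int d - 2 * int i) = q\<^sup>2 * q powi (int d - 2 * int (Suc i))" by simp
  show "q powi (int d - 2 * int (Suc i)) = (inverse q)\<^sup>2 * q powi (int d - 2 * int i)"
    unfolding * using q_not_0 by (simp add: field_simps)
qed

lemma K_psi: "K (\<psi> v) = s (q\<^sup>2) (\<psi> (K v))"
proof (rule linear_eq_if_eq_on_U [where g = "\<lambda>v. K (\<psi> v)" and h = "\<lambda>v. s (q\<^sup>2) (\<psi> (K v))"])
  show "Vector_Spaces.linear s s (\<lambda>v. K (\<psi> v))" "Vector_Spaces.linear s s (\<lambda>v. s (q\<^sup>2) (\<psi> (K v)))"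
    by (rule linear_composed [OF linear_K linear_psi] linear_scaled [OF linear_composed [OF linear_psi linear_K]])+
  fix i u assume i: "i \<le> d" "u \<in> U i"
  show "K (\<psi> u) = s (q\<^sup>2) (\<psi> (K u))"
  proof (cases i)
    case 0
    then show ?thesis unfolding K_U [OF i] using i psi_U_0 by (simp add: K_simps psi_simps)
  next
    case (Suc j)
    then have j: "j \<le> d" "\<psi> u \<in> U j" using i psi_U_Suc by simp_all
    show ?thesis
      unfolding K_U [OF i] K_U [OF j] weight_step(1) [of j] Suc by (simp add: psi_simps)
  qed
qed

lemma K_R: "K (R v) = s ((inverse q)\<^sup>2) (R (K v))"
proof (rule linear_eq_if_eq_on_U [where g = "\<lambda>v. K (R v)" and h = "\<lambda>v. s ((inverse q)\<^sup>2) (R (K v))"])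
  show "Vector_Spaces.linear s s (\<lambda>v. K (R v))" "Vector_Spaces.linear s s (\<lambda>v. s ((inverse q)\<^sup>2) (R (K v)))"
    by (rule linear_composed [OF linear_K linear_R] linear_scaled [OF linear_composed [OF linear_R linear_K]])+
  fix i u assume i: "i \<le> d" "u \<in> U i"
  have Ru: "R u \<in> U (Suc i)" using i by (intro R_mem_U)
  show "K (R u) = s ((inverse q)\<^sup>2) (R (K u))"
  proof (cases "Suc i \<le> d")
    case True
    then show ?thesis
      unfolding K_U [OF i] K_U [OF True Ru] weight_step(2) [of i] by (simp add: R_simps)
  next
    case False
    then have "R u = 0" using Ru U_beyond [of "Suc i"] by simp
    then show ?thesis unfolding K_U [OF i] by (simp add: K_simps R_simps)
  qed
qed

sublocale uq: finite_dimensional_uq_operators s q e f K Kinv Basis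
proof (intro finite_dimensional_uq_operators.intro uq_operators.intro uq_operators_axioms.intro
    vector_space_axioms finite_dimensional_vector_space_axioms q_not_0 q_squared_not_1
    linear_scaled [OF linear_psi] linear_scaled [OF linear_R] linear_K linear_Kinv K_Kinv Kinv_K)
  show "K (e v) = s (q\<^sup>2) (e (K v))" for v
    by (simp add: K_simps K_psi mult.commute)
  show "K (f v) = s ((inverse q)\<^sup>2) (f (K v))" for v
    by (simp add: K_simps K_R mult.commute)
  show "e (f v) - f (e v) = s (1 / (q - inverse q)) (K v - Kinv v)" for v
  proof -
    have "e (f v) - f (e v) = s (inverse (q - inverse q) * inverse (q - inverse q)) (\<psi> (R v) - R (\<psi> v))"
      by (simp add: psi_simps R_simps scale_right_diff_distrib)
    also have "\<dots> = s (inverse (q - inverse q)) (K v - Kinv v)"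
      unfolding psi_R using q_diff_not_0 by simp
    finally show ?thesis by (simp add: inverse_eq_divide)
  qed
qed

lemma q_powi_not_1:
  assumes "\<bar>z\<bar> \<le> int d" "q powi (2 * z) = 1"
  shows "z = 0"
proof (rule ccontr)
  assume "z \<noteq> 0"
  let ?n = "nat \<bar>z\<bar>"
  have "q powi (2 * int ?n) = 1"
  proof (cases "z \<ge> 0")
    case False
    then have "q powi (2 * int ?n) = inverse (q powi (2 * z))" by (simp flip: power_int_minus)
    then show ?thesis using assms(2) by simp
  qed (use assms in simp)
  moreover have "1 \<le> ?n" "?n \<le> d" using assms(1) \<open>z \<noteq> 0\<close> by auto
  ultimately show False using q_power_not_1 by blast
qed

lemma qnum_eq_0: "\<bar>z\<bar> \<le> int d \<Longrightarrow> qnum q z = 0 \<Longrightarrow> z = 0"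
  using q_powi_not_1 qnum_eq_0_imp [OF q_not_0 q_squared_not_1] by blast

lemma qint_not_0: "1 \<le> j \<Longrightarrow> j \<le> d \<Longrightarrow> qint q j \<noteq> 0"
  using qnum_eq_0 [of "int j"] by (auto simp: qint_eq_qnum q_not_0)

lemma f_power: "(f ^^ m) v = s (inverse (q - inverse q) ^ m) ((R ^^ m) v)"
  by (induction m) (simp_all add: R_simps)

lemma K_space_highest_weight_vector:
  assumes "2 * i \<le> d" "u \<in> K_space i" "u \<noteq> 0"
  shows "uq.highest_weight_vector (d - 2 * i) u"
  unfolding uq.highest_weight_vector_def
proof (intro conjI assms(3))
  show "e u = 0" using assms by (simp add: psi_K_space)
  have "u \<in> U i" using assms(2) K_space_subset_U by blast
  then show "K u = s (q powi int (d - 2 * i)) u" using assms(1) by (simp add: K_U of_nat_diff)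
  show "(f ^^ Suc (d - 2 * i)) u = 0"
    unfolding f_power using R_power_K_space [OF assms(1,2)] by simp
qed

text \<open>
  A submodule that contains every \<open>K_space i\<close> is \<open>V\<close>.  So a proper submodule misses some
  nonzero \<open>u\<close> in some \<open>K_space i\<close>, and with it the irreducible module generated by \<open>u\<close>.
\<close>

lemma semisimple: "uq_semisimple q s UNIV uq.act"
proof (rule uq.semisimple_if_irreducibles_exhaust)
  fix S assume S: "uq.stable S" "S \<noteq> UNIV"
  have "\<exists>i. 2 * i \<le> d \<and> \<not> K_space i \<subseteq> S"
  proof (rule ccontr)
    assume "\<nexists>i. 2 * i \<le> d \<and> \<not> K_space i \<subseteq> S"
    moreover have "R v \<in> S" if "v \<in> S" for v
    proof -
      have "f v \<in> S" using S(1) that by (auto simp: uq.stable_def)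
      then have "s (q - inverse q) (f v) \<in> S"
        by (rule subspace_scale [OF uq.stable_subspace [OF S(1)]])
      then show ?thesis using q_diff_not_0 by simp
    qed
    ultimately have "U i \<subseteq> S" for i
      using U_subset_if_contains_K_spaces [OF uq.stable_subspace [OF S(1)]] by blast
    then have "span (\<Union>i\<in>{..d}. U i) \<subseteq> S"
      by (intro span_minimal uq.stable_subspace S(1)) blast
    then show False using S(2) span_U by blast
  qed
  then obtain i u where u: "2 * i \<le> d" "u \<in> K_space i" "u \<notin> S" by blast
  have "u \<noteq> 0" using u(3) subspace_0 [OF uq.stable_subspace [OF S(1)]] by blast
  note hw = K_space_highest_weight_vector [OF u(1,2) this]
  have nz: "qint q j \<noteq> 0" if "1 \<le> j" "j \<le> d - 2 * i" for j
    using that by (intro qint_not_0) auto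
  let ?M = "uq.string_module (d - 2 * i) u"
  have "uq.stable ?M" "uq_irreducible q s ?M uq.act" "u \<in> ?M"
    using uq.stable_string_module [OF hw nz] uq.irreducible_string_module [OF hw nz]
      uq.generator_mem_string_module [OF hw nz] by blast+
  then show "\<exists>M. uq.stable M \<and> uq_irreducible q s M uq.act \<and> \<not> M \<subseteq> S"
    using u(3) by blast
qed

text \<open>
  The weights \<open>q ^ (d - 2i)\<close> are distinct, so the split components of a vector of \<open>W\<close>
  lie in \<open>W\<close>.
\<close>

lemma stable_weight_vector:
  assumes "uq.stable W" "W \<noteq> {0}"
  obtains i u where "i \<le> d" "u \<in> W" "u \<in> U i" "u \<noteq> 0"
proof -
  have sub: "subspace W" using assms(1) by (rule uq.stable_subspace)
  obtain w where w: "w \<in> W" "w \<noteq> 0" using assms(2) subspace_0 [OF sub] by blast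
  obtain u where u: "\<And>i. i \<le> d \<Longrightarrow> u i \<in> U i" "w = (\<Sum>i\<le>d. u i)"
    using split_decomposition [of w] by blast
  have inj: "inj_on (\<lambda>i. q powi (int d - 2 * int i)) {..d}"
  proof (rule inj_onI)
    fix i j assume ij: "i \<in> {..d}" "j \<in> {..d}"
      "q powi (int d - 2 * int i) = q powi (int d - 2 * int j)"
    have "2 * (int j - int i) = (int d - 2 * int i) + - (int d - 2 * int j)" by simp
    then have "q powi (2 * (int j - int i)) = 1"
      using ij(3) power_int_mult_self [OF q_not_0] q_not_0 by (metis power_int_add)
    moreover have "\<bar>int j - int i\<bar> \<le> int d" using ij by auto
    ultimately show "i = j" using q_powi_not_1 by fastforce
  qed
  have "\<forall>i\<in>{..d}. u i \<in> W"
    by (rule eigenvector_components_mem [OF linear_K sub _ _ inj])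
       (use assms(1) u w K_U in \<open>auto simp: uq.stable_def\<close>)
  moreover have "\<exists>i\<in>{..d}. u i \<noteq> 0" using w(2) u(2) by (metis sum.neutral)
  ultimately show ?thesis using u(1) that by blast
qed

text \<open>
  Let \<open>f ^ m u\<close> be the last nonzero vector of the string of \<open>u\<close>.  By \<open>e_f_powers\<close>,
  \<open>[m + 1] [d - 2i - m] = 0\<close>.  Since \<open>m \<le> d - i\<close>, both indices are bounded by \<open>d\<close> in
  absolute value, except that \<open>m + 1 = d + 1\<close> may occur; then \<open>i = 0\<close> and \<open>m = d - 2i\<close>
  holds anyway.  In the other cases the second index must be zero.
\<close>

lemma vector_killed_by_e_highest_weight:
  assumes i: "i \<le> d" and u: "u \<in> U i" "u \<noteq> 0" "e u = 0"
  shows "2 * i \<le> d \<and> uq.highest_weight_vector (d - 2 * i) u"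
proof -
  have f_U: "(f ^^ m) u \<in> U (i + m)" for m
    unfolding f_power by (intro subspace_scale subspace_U R_power_mem_U u)
  have vanish: "(f ^^ (Suc d - i)) u = 0"
    using f_U [of "Suc d - i"] i U_beyond [of "Suc d"] by simp
  define l where "l = (LEAST m. (f ^^ m) u = 0)"
  have l: "(f ^^ l) u = 0" "l \<le> Suc d - i"
    unfolding l_def by (rule LeastI [where P = "\<lambda>m. (f ^^ m) u = 0", OF vanish],
      rule Least_le [where P = "\<lambda>m. (f ^^ m) u = 0", OF vanish])
  have below: "(f ^^ m) u \<noteq> 0" if "m < l" for m
    using not_less_Least [of m "\<lambda>m. (f ^^ m) u = 0"] that by (simp add: l_def)
  have "l \<noteq> 0" using l(1) u(2) by (intro notI) simp
  then obtain m where m: "l = Suc m" by (cases l) auto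
  have weight: "K u = s (q powi (int d - 2 * int i)) u" using K_U i u by blast
  have "s (qnum q (int m + 1) * qnum q (int d - 2 * int i - int m)) ((f ^^ m) u) = e ((f ^^ Suc m) u)"
    by (rule uq.e_f_powers [OF u(3) weight, symmetric])
  also have "\<dots> = 0" unfolding l(1) [unfolded m] by (simp add: psi_simps)
  finally have zero: "qnum q (int m + 1) = 0 \<or> qnum q (int d - 2 * int i - int m) = 0"
    using below [of m] m by simp
  have mi: "m + i \<le> d" using l(2) m by simp
  have "int m = int d - 2 * int i"
  proof (cases "m = d")
    case False
    then have "qnum q (int m + 1) \<noteq> 0" using qnum_eq_0 [of "int m + 1"] mi by auto
    then have "qnum q (int d - 2 * int i - int m) = 0" using zero by simp
    then show ?thesis using qnum_eq_0 [of "int d - 2 * int i - int m"] mi by linarith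
  qed (use mi in simp)
  then have "2 * i \<le> d" "m = d - 2 * i" by simp_all
  then show ?thesis
    using u weight l(1) m by (simp add: uq.highest_weight_vector_def of_nat_diff)
qed

text \<open>
  Since \<open>e\<close> lowers the index by one, a weight vector of least index in \<open>W\<close> is killed
  by \<open>e\<close>, and its string spans \<open>W\<close> by irreducibility.
\<close>

lemma irreducible_isomorphic_L:
  assumes "uq.stable W" "uq_irreducible q s W uq.act"
  shows "\<exists>i. 2 * i \<le> d \<and>
    uq_isomorphic q s W uq.act L_scale (L_carrier (d - 2 * i)) (L_action q (d - 2 * i) 1)"
proof -
  have irr: "W \<noteq> {0}" "\<And>M. uq.stable M \<Longrightarrow> M \<subseteq> W \<Longrightarrow> M = {0} \<or> M = W"
    using assms uq.uq_irreducible_iff_stable by blast+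
  let ?P = "\<lambda>i. i \<le> d \<and> (\<exists>u. u \<in> W \<and> u \<in> U i \<and> u \<noteq> 0)"
  have "\<exists>i. ?P i" using stable_weight_vector [OF assms(1) irr(1)] by blast
  then have "?P (LEAST i. ?P i)" by (rule LeastI_ex)
  then obtain i u where i: "i = (LEAST i. ?P i)" "i \<le> d" and u: "u \<in> W" "u \<in> U i" "u \<noteq> 0"
    by blast
  have "e u = 0"
  proof (cases i)
    case 0
    then show ?thesis using psi_U_0 u by simp
  next
    case (Suc j)
    then have "\<psi> u \<in> U j" using psi_U_Suc u i by simp
    then have "e u \<in> U j" by (intro subspace_scale subspace_U)
    moreover have "e u \<in> W" using assms(1) u(1) by (auto simp: uq.stable_def)
    moreover have "\<not> ?P j" by (rule not_less_Least) (use Suc i in simp)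
    ultimately show ?thesis using Suc i(2) by auto
  qed
  then have hw: "2 * i \<le> d" "uq.highest_weight_vector (d - 2 * i) u"
    using vector_killed_by_e_highest_weight i u by blast+
  have nz: "qint q j \<noteq> 0" if "1 \<le> j" "j \<le> d - 2 * i" for j
    using that by (intro qint_not_0) auto
  let ?M = "uq.string_module (d - 2 * i) u"
  have "?M \<subseteq> W" by (rule uq.string_module_subset_stable [OF hw(2) nz assms(1) u(1)])
  moreover have "u \<in> ?M" by (rule uq.generator_mem_string_module [OF hw(2) nz])
  ultimately have "?M = W"
    using irr(2) [OF uq.stable_string_module [OF hw(2) nz]] u(3) by blast
  then show ?thesis
    using uq.isomorphic_string_module [OF hw(2) nz] hw(1) by blast
qed

end

text \<open>
  If \<open>q ^ (2n) = 1\<close>, then the eigenvalues with indices \<open>0\<close> and \<open>n\<close> coincide.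
\<close>

lemma q_racah_eigenvalue_power:
  fixes q a :: "'k::field"
  assumes "q \<noteq> 0"
    and "inj_on (\<lambda>i. a * q powi (int d - 2 * int i) + inverse a * q powi (2 * int i - int d)) {..d}"
    and "1 \<le> n" "n \<le> d"
  shows "q powi (2 * int n) \<noteq> 1"
proof
  assume 1: "q powi (2 * int n) = 1"
  have "q powi (int d - 2 * int n) = q powi int d / q powi (2 * int n)"
    "q powi (2 * int n - int d) = q powi (2 * int n) / q powi int d"
    by (rule power_int_diff; use assms(1) in simp)+
  then have "a * q powi (int d - 2 * int n) + inverse a * q powi (2 * int n - int d)
      = a * q powi (int d - 2 * int 0) + inverse a * q powi (2 * int 0 - int d)"
    by (simp add: 1 power_int_minus divide_inverse)
  then have "n = 0"
    using inj_onD [OF assms(2), of n 0] assms(4) by blast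
  with assms(3) show False by simp
qed

theorem lemma7p11:
  fixes s :: "'k::alg_closed_field \<Rightarrow> 'v::ab_group_add \<Rightarrow> 'v"
    and Basis :: "'v set"
    and d :: nat
    and A As K \<psi> :: "'v \<Rightarrow> 'v"
    and E Es :: "nat \<Rightarrow> 'v \<Rightarrow> 'v"
    and q a b :: 'k
  defines "R \<equiv> R_map s A a K"
  defines "act \<equiv> uq_action s (\<lambda>v. s (inverse (q - inverse q)) (\<psi> v))
                              (\<lambda>v. s (inverse (q - inverse q)) (R v)) K (inv_into UNIV K)"
  assumes "finite_dimensional_vector_space s Basis"
    and "\<exists>v::'v. v \<noteq> 0"
    and "d \<ge> 1"
    and "td_system s d A E As Es"
    and "q_racah_type s d A E As Es q a b"
    and "is_K_map s d E Es q K"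
    and "is_psi_map s d E Es q K R \<psi>"
  shows "uq_semisimple q s UNIV act \<and>
         (\<forall>W. uq_submodule q s UNIV act W \<and> uq_irreducible q s W act \<longrightarrow>
            (\<exists>i. 2 * i \<le> d \<and>
               uq_isomorphic q s W act
                 L_scale (L_carrier (d - 2 * i)) (L_action q (d - 2 * i) 1)))"
proof -
  define \<theta> where "\<theta> i = a * q powi (int d - 2 * int i) + inverse a * q powi (2 * int i - int d)" for i
  define \<theta>s where "\<theta>s i = b * q powi (int d - 2 * int i) + inverse b * q powi (2 * int i - int d)" for i
  have q: "q \<noteq> 0" "q ^ 4 \<noteq> 1"
    and ran: "\<forall>i\<le>d. range (E i) = eigenspace s A (\<theta> i)" "\<forall>i\<le>d. range (Es i) = eigenspace s As (\<theta>s i)"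
    using \<open>q_racah_type s d A E As Es q a b\<close> by (simp_all add: q_racah_type_def \<theta>_def \<theta>s_def)
  have q2: "q\<^sup>2 \<noteq> 1"
  proof
    assume "q\<^sup>2 = 1"
    then have "(q\<^sup>2)\<^sup>2 = 1" by simp
    then show False using q(2) by (simp flip: power_mult)
  qed
  interpret td: td_operators s Basis d A As E Es \<theta> \<theta>s
    by (rule td_system_td_operators [OF assms(3) \<open>td_system s d A E As Es\<close> ran])
  have split_U_eq: "split_U d E Es i = td.U i" if "i \<le> d" for i
  proof -
    have "td.dual.eigen_sum {0..i} = td.dual.eigen_sum {..<Suc i}"
      by (intro equalityI td.dual.eigen_sum_mono) auto
    moreover have "td.plain.eigen_sum {i..d} = td.plain.eigen_sum {i..}"
      by (intro equalityI td.plain.eigen_sum_mono) auto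
    moreover have "{0..i} \<subseteq> {..d}" "{i..d} \<subseteq> {..d}" using that by auto
    ultimately show ?thesis
      unfolding split_U_def td.U_def
      by (simp only: td.plain.subspace_sum_range_E td.dual.subspace_sum_range_E)
  qed
  have split_K_eq: "split_K d E Es i = td.dual.eigen_sum {..<Suc i} \<inter> td.plain.eigen_sum {i..d - i}"
    if "2 * i \<le> d" for i
  proof -
    have "td.dual.eigen_sum {0..i} = td.dual.eigen_sum {..<Suc i}"
      by (intro equalityI td.dual.eigen_sum_mono) auto
    moreover have "{0..i} \<subseteq> {..d}" "{i..d - i} \<subseteq> {..d}" using that by auto
    ultimately show ?thesis
      unfolding split_K_def
      by (simp only: td.plain.subspace_sum_range_E td.dual.subspace_sum_range_E)
  qed
  have lin_K: "Vector_Spaces.linear s s K"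
    using \<open>is_K_map s d E Es q K\<close> unfolding is_K_map_def by blast
  have K_U: "K u = s (q powi (int d - 2 * int i)) u" if "i \<le> d" "u \<in> td.U i" for i u
    using \<open>is_K_map s d E Es q K\<close> that split_U_eq [of i] unfolding is_K_map_def by blast
  interpret pair: finite_dimensional_vector_space_pair s Basis s Basis by unfold_locales
  \<comment> \<open>\<open>K\<close> acts on each \<open>U i\<close> by a nonzero scalar and the \<open>U i\<close> span \<open>V\<close>, so \<open>K\<close> is invertible\<close>
  have "td.U i \<subseteq> range K" if "i \<le> d" for i
  proof
    fix u assume u: "u \<in> td.U i"
    have "K (s (inverse (q powi (int d - 2 * int i))) u) = u"
      using q(1) by (simp add: linear_map_scale [OF lin_K] K_U [OF that u])
    then show "u \<in> range K" by (metis rangeI)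
  qed
  then have "(\<Union>i\<in>{..d}. td.U i) \<subseteq> range K" by auto
  moreover have "td.subspace (range K)"
    by (rule module_hom.subspace_image [of s s K UNIV]) (use lin_K in \<open>simp_all add: Vector_Spaces.linear_def\<close>)
  ultimately have "td.span (\<Union>i\<in>{..d}. td.U i) \<subseteq> range K" by (rule td.span_minimal)
  then have surj: "surj K" using td.span_U by blast
  then have inj: "inj K" by (rule pair.linear_surjective_imp_injective [OF lin_K]) simp
  let ?Kinv = "inv_into UNIV K"
  have K_Kinv: "K (?Kinv v) = v" "?Kinv (K v) = v" for v
    using surj inj by (simp_all add: surj_f_inv_f)
  have lin_Kinv: "Vector_Spaces.linear s s ?Kinv"
    by (rule td.inj_linear_imp_inv_linear [OF lin_K inj])
  have R: "R v = A v - s a (K v) - s (inverse a) (?Kinv v)" for v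
    by (simp add: R_def R_map_def)
  have lin_R: "Vector_Spaces.linear s s R"
  proof (intro iffD2 [OF Vector_Spaces.linear_iff] conjI allI td.vector_space_axioms)
    show "R (x + y) = R x + R y" for x y
      by (simp add: R td.plain.A_simps linear_map_add [OF lin_K] linear_map_add [OF lin_Kinv]
          td.scale_right_distrib)
    show "R (s c x) = s c (R x)" for c x
      by (simp add: R td.plain.A_simps linear_map_scale [OF lin_K] linear_map_scale [OF lin_Kinv]
          td.scale_right_diff_distrib mult.commute)
  qed
  have R_U: "R u = A u - s (\<theta> i) u" if "i \<le> d" "u \<in> td.U i" for i u
  proof -
    have "2 * int i - int d = - (int d - 2 * int i)" by simp
    then have weight: "q powi (2 * int i - int d) = inverse (q powi (int d - 2 * int i))"
      by (metis power_int_minus)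
    have "K (s (inverse (q powi (int d - 2 * int i))) u) = u"
      using q(1) by (simp add: linear_map_scale [OF lin_K] K_U [OF that])
    then have "?Kinv u = s (q powi (2 * int i - int d)) u"
      using K_Kinv(2) weight by metis
    then show ?thesis
      unfolding R \<theta>_def K_U [OF that] by (simp add: td.scale_left_distrib)
  qed
  interpret raising: td_raising s Basis d A As E Es \<theta> \<theta>s R
    by (intro td_raising.intro td_raising_axioms.intro td.td_operators_axioms lin_R R_U)
  have psi: "Vector_Spaces.linear s s \<psi>"
    "\<And>v. \<psi> (R v) - R (\<psi> v) = s (q - inverse q) (K v - ?Kinv v)"
    "\<And>i u. 2 * i \<le> d \<Longrightarrow> u \<in> raising.K_space i \<Longrightarrow> \<psi> u = 0"
    using \<open>is_psi_map s d E Es q K R \<psi>\<close> split_K_eq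
    unfolding is_psi_map_def raising.K_space_def by blast+
  interpret split_module s Basis d A As E Es \<theta> \<theta>s R q K ?Kinv \<psi>
  proof (intro split_module.intro split_module_axioms.intro raising.td_raising_axioms
      q q2 lin_K lin_Kinv K_U K_Kinv psi)
    show "q powi (2 * int n) \<noteq> 1" if "1 \<le> n" "n \<le> d" for n
      using q_racah_eigenvalue_power [OF q(1) _ that, of a] td.plain.inj_eigenvalues
      by (simp add: \<theta>_def [abs_def])
  qed
  show ?thesis
    unfolding act_def
    using semisimple irreducible_isomorphic_L by (simp add: uq.uq_submodule_iff_stable)
qed

end
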